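(* Let $\alpha,\beta,v\in\mathbb R$ with $|\alpha-\beta|<|v|<\alpha+\beta+2$, let $W$ be the $2\times2$ Jacobi-type weight defined in the context, $\tilde W(x)=(1-x)^{\alpha+1}(1+x)^{\beta+1}I$, and let $\mathcal V,\mathcal N,\mathcal A,Z_1,Z_2$ be the differential operators defined in the context ($Z_1$ and $Z_2$ have orders four and six respectively). The center $\mathcal Z(W)$ of the algebra $\mathcal D(W)$ is generated by $\{I,Z_1,Z_2\}$. Explicitly, $$\mathcal Z(W)=\mathbb CI\oplus\mathcal N\,\mathcal Z(\tilde W)\,\mathcal A\,\mathcal V.$$
   Context: The weight: $W(x)=(1-x)^\alpha(1+x)^\beta\big(W_2\frac{(1-x)^2}{4}+W_1\frac{1-x}{2}+W_0\big)$ for $x\in(-1,1)$, where $$W_2=\begin{pmatrix}\frac{v(v+2+\alpha+\beta)}{v+\alpha-\beta}&0\\0&\frac{v(-v+2+\alpha+\beta)}{v-\alpha+\beta}\end{pmatrix},\quad W_1=\begin{pmatrix}-(v+\alpha+\beta+2)&\alpha+\beta+2\\\alpha+\beta+2&-(-v+\alpha+\beta+2)\end{pmatrix},\quad W_0=\begin{pmatrix}\alpha+1&-\alpha-1\\-\alpha-1&\alpha+1\end{pmatrix}.$$ The operators: $$\mathcal V=\partial\begin{pmatrix}x+\frac{\beta-\alpha}{v}&1+\frac{\beta-\alpha}{v}\\1+\frac{\alpha-\beta}{v}&x+\frac{\alpha-\beta}{v}\end{pmatrix}+\begin{pmatrix}\frac{v+2+\alpha+\beta}{2}&0\\0&\frac{-v+2+\alpha+\beta}{2}\end{pmatrix},$$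 $$\mathcal N=\partial\begin{pmatrix}-x+\frac{\beta-\alpha}{v}&1+\frac{\beta-\alpha}{v}\\1+\frac{\alpha-\beta}{v}&-x+\frac{\alpha-\beta}{v}\end{pmatrix}+\begin{pmatrix}-\frac12(-v+4+\alpha+\beta)&0\\0&-\frac12(\alpha+\beta+v+4)\end{pmatrix}.$$ With $\delta=\delta_{\alpha+1,\beta+1}=\partial^2(1-x^2)+\partial(\beta-\alpha-x(\alpha+\beta+4))$, the second-order operator of the scalar Jacobi weight $(1-x)^{\alpha+1}(1+x)^{\beta+1}$, $$\mathcal A=\begin{pmatrix}\delta-\frac14(\alpha+\beta+v+4)(-v+2+\alpha+\beta)&0\\0&\delta-\frac14(-v+4+\alpha+\beta)(v+2+\alpha+\beta)\end{pmatrix}.$$ Let $D_1=\mathcal N\begin{pmatrix}1&0\\0&0\end{pmatrix}\mathcal V$ and $D_4=\mathcal N\begin{pmatrix}0&0\\0&1\end{pmatrix}\mathcal V$. Then $Z_1=\mathcal N\mathcal A\mathcal V$ and $Z_2=\mathcal N\,(\delta I)\,\mathcal A\mathcal V$; in terms of $D_1,D_4$, $$Z_1=D_1^2+D_4^2+v(D_1-D_4),$$ $$Z_2=D_1^3+D_4^3+\tfrac14(-v+4+\alpha+\beta)(v+2+\alpha+\beta)(D_1^2+vD_1)+\tfrac14(-v+2+\alpha+\beta)(v+4+\alpha+\beta)(D_4^2-vD_4)+v(D_1^2-D_4^2).$$ Conventions: for a weight matrix $U$ of size 2, $\{P_n\}$ denotes the monic matrix polynomials orthogonal for $\langle P,Q\rangle_U=\int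 P(x)U(x)Q(x)^*dx$. Matrix differential operators $D=\sum_j\partial^jF_j(x)$ with $F_j\in\operatorname{Mat}_2(\mathbb C[x])$, forming the algebra $\operatorname{Mat}_2(\Omega[x])$, act on the right: $P\cdot D=\sum_j\partial^j(P)F_j$, and $P\cdot(DE)=(P\cdot D)\cdot E$. $\mathcal D(U)=\{D\in\operatorname{Mat}_2(\Omega[x]):\text{for all }n\ge0,\ P_n\cdot D=\Lambda_n(D)P_n\text{ for some }\Lambda_n(D)\in\operatorname{Mat}_2(\mathbb C)\}$, and $\mathcal Z(U)$ is its center. Generated means as a $\mathbb C$-algebra. *)

theory Defs
  imports "HOL-Analysis.Analysis" "HOL-Computational_Algebra.Polynomial"
begin

type_synonym cmatrix = "complex^2^2"
type_synonym mpoly = "complex poly^2^2"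

definition mat2 :: "'a::zero \<Rightarrow> 'a \<Rightarrow> 'a \<Rightarrow> 'a \<Rightarrow> 'a^2^2" where
  "mat2 a b c d = vector [vector [a, b], vector [c, d]]"

definition adjoint_mat :: "cmatrix \<Rightarrow> cmatrix" where
  "adjoint_mat M = (\<chi> i j. cnj (M $ j $ i))"

definition complex_mat :: "real^2^2 \<Rightarrow> cmatrix" where
  "complex_mat M = (\<chi> i j. complex_of_real (M $ i $ j))"

definition const_mpoly :: "cmatrix \<Rightarrow> mpoly" where
  "const_mpoly M = (\<chi> i j. [:M $ i $ j:])"

definition mpoly_coeff :: "mpoly \<Rightarrow> nat \<Rightarrow> cmatrix" where
  "mpoly_coeff P k = (\<chi> i j. coeff (P $ i $ j) k)"

definition mpoly_eval :: "mpoly \<Rightarrow> real \<Rightarrow> cmatrix" where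
  "mpoly_eval P x = (\<chi> i j. poly (P $ i $ j) (complex_of_real x))"

definition mpoly_deriv :: "mpoly \<Rightarrow> mpoly" where
  "mpoly_deriv P = (\<chi> i j. pderiv (P $ i $ j))"

definition monic_of_degree :: "nat \<Rightarrow> mpoly \<Rightarrow> bool" where
  "monic_of_degree n P \<longleftrightarrow> mpoly_coeff P n = mat 1 \<and> (\<forall>k>n. mpoly_coeff P k = 0)"

section \<open>Matrix differential operators\<close>

text \<open>
  A matrix differential operator is identified with its right action on matrix polynomials; in
  characteristic zero the coefficients are determined by this action. The list
  \<open>[F\<^sub>0, F\<^sub>1, \<dots>]\<close> stands for the operator sending \<open>P\<close> to the sum over \<open>j\<close> of the \<open>j\<close>-th derivative
  of \<open>P\<close> times \<open>F\<^sub>j\<close>, the coefficients being multiplied on the right.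
\<close>

type_synonym mop = "mpoly \<Rightarrow> mpoly"

definition diffop :: "mpoly list \<Rightarrow> mop" where
  "diffop Fs = (\<lambda>P. \<Sum>j<length Fs. (mpoly_deriv ^^ j) P ** (Fs ! j))"

definition diffops :: "mop set" where
  "diffops = range diffop"

definition op_order :: "mop \<Rightarrow> nat" where
  "op_order D = (LEAST n. \<exists>Fs. length Fs = Suc n \<and> D = diffop Fs)"

definition op_add :: "mop \<Rightarrow> mop \<Rightarrow> mop" (infixl "\<oplus>\<^sub>o" 65) where
  "D \<oplus>\<^sub>o E = (\<lambda>P. D P + E P)"

text \<open>The product is that of a right action: the left factor is applied first.\<close>

definition op_mult :: "mop \<Rightarrow> mop \<Rightarrow> mop" (infixl "\<odot>\<^sub>o" 70) where
  "D \<odot>\<^sub>o E = (\<lambda>P. E (D P))"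

definition op_zero :: mop where
  "op_zero = (\<lambda>P. 0)"

definition op_scalar :: "complex \<Rightarrow> mop" where
  "op_scalar c = diffop [mat [:c:]]"

definition op_center :: "mop set \<Rightarrow> mop set" where
  "op_center S = {D \<in> S. \<forall>E\<in>S. D \<odot>\<^sub>o E = E \<odot>\<^sub>o D}"

inductive_set generated_algebra :: "mop set \<Rightarrow> mop set" for G :: "mop set" where
  gen: "D \<in> G \<Longrightarrow> D \<in> generated_algebra G"
| zero: "op_zero \<in> generated_algebra G"
| add: "D \<in> generated_algebra G \<Longrightarrow> E \<in> generated_algebra G \<Longrightarrow> D \<oplus>\<^sub>o E \<in> generated_algebra G"
| scale: "D \<in> generated_algebra G \<Longrightarrow> op_scalar c \<odot>\<^sub>o D \<in> generated_algebra G"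
| mult: "D \<in> generated_algebra G \<Longrightarrow> E \<in> generated_algebra G \<Longrightarrow> D \<odot>\<^sub>o E \<in> generated_algebra G"

text \<open>Intended for linear subspaces \<open>X\<close> and \<open>Y\<close>.\<close>

definition is_direct_sum :: "mop set \<Rightarrow> mop set \<Rightarrow> mop set \<Rightarrow> bool" where
  "is_direct_sum S X Y \<longleftrightarrow> S = {D \<oplus>\<^sub>o E | D E. D \<in> X \<and> E \<in> Y} \<and> X \<inter> Y = {op_zero}"

section \<open>Orthogonal polynomials and the algebra of a weight\<close>

text \<open>Weights are supported on the open interval from \<open>-1\<close> to \<open>1\<close>.\<close>

definition weight_inner :: "(real \<Rightarrow> cmatrix) \<Rightarrow> mpoly \<Rightarrow> mpoly \<Rightarrow> cmatrix" where
  "weight_inner U P Q = (\<chi> i j. LINT x:{-1<..<1}|lborel.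
     (mpoly_eval P x ** U x ** adjoint_mat (mpoly_eval Q x)) $ i $ j)"

definition monic_orthogonal :: "(real \<Rightarrow> cmatrix) \<Rightarrow> (nat \<Rightarrow> mpoly) \<Rightarrow> bool" where
  "monic_orthogonal U P \<longleftrightarrow> (\<forall>n. monic_of_degree n (P n)) \<and>
     (\<forall>m n. m \<noteq> n \<longrightarrow> weight_inner U (P m) (P n) = 0)"

text \<open>
  For a weight matrix the monic orthogonal sequence exists and is unique, so the existential
  quantifier over \<open>P\<close> only names it.
\<close>

definition weight_algebra :: "(real \<Rightarrow> cmatrix) \<Rightarrow> mop set" where
  "weight_algebra U = {D \<in> diffops. \<exists>P. monic_orthogonal U P \<and>
     (\<forall>n. \<exists>L. D (P n) = const_mpoly L ** P n)}"

definition weight_center :: "(real \<Rightarrow> cmatrix) \<Rightarrow> mop set" where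
  "weight_center U = op_center (weight_algebra U)"

section \<open>The Jacobi-type weight and its operators\<close>

definition W2 :: "real \<Rightarrow> real \<Rightarrow> real \<Rightarrow> real^2^2" where
  "W2 \<alpha> \<beta> v = mat2 (v * (v + 2 + \<alpha> + \<beta>) / (v + \<alpha> - \<beta>)) 0
                    0 (v * (- v + 2 + \<alpha> + \<beta>) / (v - \<alpha> + \<beta>))"

definition W1 :: "real \<Rightarrow> real \<Rightarrow> real \<Rightarrow> real^2^2" where
  "W1 \<alpha> \<beta> v = mat2 (- (v + \<alpha> + \<beta> + 2)) (\<alpha> + \<beta> + 2)
                    (\<alpha> + \<beta> + 2) (- (- v + \<alpha> + \<beta> + 2))"

definition W0 :: "real \<Rightarrow> real^2^2" where
  "W0 \<alpha> = mat2 (\<alpha> + 1) (- \<alpha> - 1) (- \<alpha> - 1) (\<alpha> + 1)"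

definition W :: "real \<Rightarrow> real \<Rightarrow> real \<Rightarrow> real \<Rightarrow> cmatrix" where
  "W \<alpha> \<beta> v x = complex_mat (((1 - x) powr \<alpha> * (1 + x) powr \<beta>) *\<^sub>R
     (((1 - x)^2 / 4) *\<^sub>R W2 \<alpha> \<beta> v + ((1 - x) / 2) *\<^sub>R W1 \<alpha> \<beta> v + W0 \<alpha>))"

definition W_tilde :: "real \<Rightarrow> real \<Rightarrow> real \<Rightarrow> cmatrix" where
  "W_tilde \<alpha> \<beta> x = complex_mat (((1 - x) powr (\<alpha> + 1) * (1 + x) powr (\<beta> + 1)) *\<^sub>R mat 1)"

text \<open>The polynomial \<open>a + b x\<close> with real coefficients.\<close>

definition lin :: "real \<Rightarrow> real \<Rightarrow> complex poly" where
  "lin a b = [:complex_of_real a, complex_of_real b:]"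

definition op_V :: "real \<Rightarrow> real \<Rightarrow> real \<Rightarrow> mop" where
  "op_V \<alpha> \<beta> v = diffop
     [mat2 (lin ((v + 2 + \<alpha> + \<beta>) / 2) 0) 0
           0 (lin ((- v + 2 + \<alpha> + \<beta>) / 2) 0),
      mat2 (lin ((\<beta> - \<alpha>) / v) 1) (lin (1 + (\<beta> - \<alpha>) / v) 0)
           (lin (1 + (\<alpha> - \<beta>) / v) 0) (lin ((\<alpha> - \<beta>) / v) 1)]"

definition op_N :: "real \<Rightarrow> real \<Rightarrow> real \<Rightarrow> mop" where
  "op_N \<alpha> \<beta> v = diffop
     [mat2 (lin (- (1/2) * (- v + 4 + \<alpha> + \<beta>)) 0) 0
           0 (lin (- (1/2) * (\<alpha> + \<beta> + v + 4)) 0),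
      mat2 (lin ((\<beta> - \<alpha>) / v) (- 1)) (lin (1 + (\<beta> - \<alpha>) / v) 0)
           (lin (1 + (\<alpha> - \<beta>) / v) 0) (lin ((\<alpha> - \<beta>) / v) (- 1))]"

text \<open>The scalar Jacobi operator \<open>\<delta>\<close> of the weight \<open>W_tilde\<close>, acting as \<open>\<delta>I\<close>.\<close>

definition op_delta :: "real \<Rightarrow> real \<Rightarrow> mop" where
  "op_delta \<alpha> \<beta> = diffop
     [0, mat (lin (\<beta> - \<alpha>) (- (\<alpha> + \<beta> + 4))), mat [:1, 0, - 1:]]"

definition op_A :: "real \<Rightarrow> real \<Rightarrow> real \<Rightarrow> mop" where
  "op_A \<alpha> \<beta> v = op_delta \<alpha> \<beta> \<oplus>\<^sub>o diffop
     [mat2 (lin (- (1/4) * (\<alpha> + \<beta> + v + 4) * (- v + 2 + \<alpha> + \<beta>)) 0) 0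
           0 (lin (- (1/4) * (- v + 4 + \<alpha> + \<beta>) * (v + 2 + \<alpha> + \<beta>)) 0)]"

definition Z1 :: "real \<Rightarrow> real \<Rightarrow> real \<Rightarrow> mop" where
  "Z1 \<alpha> \<beta> v = op_N \<alpha> \<beta> v \<odot>\<^sub>o op_A \<alpha> \<beta> v \<odot>\<^sub>o op_V \<alpha> \<beta> v"

definition Z2 :: "real \<Rightarrow> real \<Rightarrow> real \<Rightarrow> mop" where
  "Z2 \<alpha> \<beta> v = op_N \<alpha> \<beta> v \<odot>\<^sub>o op_delta \<alpha> \<beta> \<odot>\<^sub>o op_A \<alpha> \<beta> v \<odot>\<^sub>o op_V \<alpha> \<beta> v"

end

theory Submission
  imports Defs
begin

text \<open>
  Write \<open>\<lambda>\<^sub>n = -n(n + \<alpha> + \<beta> + 3)\<close> for the eigenvalue of \<open>\<delta>\<close> on the monic Jacobi polynomial \<open>p\<^sub>n\<close>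
  of the weight \<open>(1 - x)\<^bsup>\<alpha> + 1\<^esup> (1 + x)\<^bsup>\<beta> + 1\<^esup>\<close>. Operators act from the right, and products of
  operators are read from left to right. The operators \<open>\<V>\<close> and \<open>\<N>\<close> form a Darboux pair: \<open>\<V> \<N>\<close> is
  the diagonal matrix with entries \<open>\<delta> - r\<^sub>1\<close> and \<open>\<delta> - r\<^sub>2\<close> with constants \<open>r\<^sub>1\<close>, \<open>r\<^sub>2\<close>
  (\<open>op_V_N_entries\<close>), and up to a constant matrix \<open>\<N>\<close> is the adjoint of \<open>\<V>\<close> between the two
  weights (\<open>op_V_adjoint\<close>, integration by parts). Hence \<open>p\<^sub>n I \<cdot> \<V>\<close> is, up to an invertible
  diagonal factor, the orthogonal polynomial \<open>P\<^sub>n\<close> of \<open>W\<close>, and \<open>\<N>\<close> maps \<open>P\<^sub>n\<close> back to a multiple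
  of \<open>p\<^sub>n I\<close>. Conjugation by this pair transports all constant matrices into the algebra of \<open>W\<close>,
  so an element \<open>D\<close> of the centre has scalar eigenvalues, \<open>P\<^sub>n \<cdot> D = d(n) P\<^sub>n\<close>
  (\<open>weight_center_iff\<close>).

  It remains to find the possible \<open>d\<close>. First, \<open>d(n) = q(\<lambda>\<^sub>n)\<close> for a polynomial \<open>q\<close>. The point 1
  is singular for the hypergeometric equation, which makes every derivative of \<open>p\<^sub>n\<close> at 1 equal
  to \<open>p\<^sub>n(1)\<close> times a polynomial in \<open>\<lambda>\<^sub>n\<close> (\<open>eigenpoly_derivs_at_1\<close>); evaluating \<open>p\<^sub>n I \<cdot> \<V> D\<close> at
  1 gives the claim (\<open>weight_center_W_iff\<close>). Second, \<open>q(r\<^sub>1) = q(r\<^sub>2)\<close>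
  (\<open>eigenvalue_equal_at_roots\<close>). Subtracting from \<open>D\<close> an operator of the form \<open>\<N> G \<V>\<close> leaves an
  operator \<open>R\<close> with \<open>\<V> R = K \<V>\<close>, where \<open>K\<close> is the constant diagonal matrix with entries \<open>q(r\<^sub>1)\<close>
  and \<open>q(r\<^sub>2)\<close>. The leading coefficient of \<open>\<V>\<close> is not a zero divisor, so \<open>R\<close> has order zero;
  then \<open>R = K\<close>, and \<open>K\<close> commutes with that leading coefficient, whose off-diagonal entries are
  nonzero.

  Since \<open>r\<^sub>1 - r\<^sub>2 = v\<close> is not zero, \<open>q\<close> is a constant plus a multiple of \<open>(x - r\<^sub>1)(x - r\<^sub>2)\<close>.
  Conversely \<open>\<N> p(\<delta>) \<A> \<V>\<close> has the eigenvalue polynomial \<open>(x - r\<^sub>1)(x - r\<^sub>2) p\<close>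
  (\<open>acts_by_N_A_V\<close>), and operators are determined by their eigenvalues. This is the direct sum.
  The generators \<open>Z\<^sub>1\<close> and \<open>Z\<^sub>2\<close> belong to \<open>p = 1\<close> and \<open>p = x\<close>, and \<open>p = x\<^sup>k\<^sup>+\<^sup>2\<close> reduces to
  lower powers by multiplication with \<open>Z\<^sub>1\<close>.
\<close>

section \<open>Matrix polynomials\<close>

lemma mat2_entries [simp]:
  "mat2 a b c d $ 1 $ 1 = a" "mat2 a b c d $ 1 $ 2 = b"
  "mat2 a b c d $ 2 $ 1 = c" "mat2 a b c d $ 2 $ 2 = d"
  by (simp_all add: mat2_def)

lemma mat_mult_entry: "(mat c ** A) $ i $ j = c * A $ i $ j" for A :: "'a::comm_ring_1^2^2"
  using exhaust_2[of i] by (auto simp: matrix_matrix_mult_def mat_def sum_2)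

lemma mult_mat_entry: "(A ** mat c) $ i $ j = A $ i $ j * c" for A :: "'a::comm_ring_1^2^2"
  using exhaust_2[of j] by (auto simp: matrix_matrix_mult_def mat_def sum_2)

lemma mat_commutes: "mat c ** A = A ** mat c" for A :: "'a::comm_ring_1^2^2"
  by (simp add: vec_eq_iff mat_mult_entry mult_mat_entry mult.commute)

lemma mat_mult_mat: "mat a ** mat b = (mat (a * b) :: 'a::comm_ring_1^2^2)"
  by (simp add: vec_eq_iff mat_mult_entry) (simp add: mat_def)

lemma mat_inverse: "c \<noteq> 0 \<Longrightarrow> mat c ** mat (inverse c) = (mat 1 :: cmatrix)"
  by (simp add: mat_mult_mat)

lemma matrix_add_rdistrib: "(B + C) ** A = B ** A + C ** A" for A :: "'a::comm_ring_1^2^2"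
  by (simp add: matrix_matrix_mult_def vec_eq_iff sum_2 algebra_simps)

lemma matrix_zero_left [simp]: "0 ** A = 0" for A :: "'a::comm_ring_1^2^2"
  by (simp add: matrix_matrix_mult_def vec_eq_iff)

lemma matrix_zero_right [simp]: "A ** 0 = 0" for A :: "'a::comm_ring_1^2^2"
  by (simp add: matrix_matrix_mult_def vec_eq_iff)

definition diag :: "complex \<Rightarrow> complex \<Rightarrow> cmatrix" where
  "diag a b = mat2 a 0 0 b"

lemma diag_mult: "diag a b ** diag c d = diag (a * c) (b * d)"
  by (simp add: diag_def vec_eq_iff forall_2 matrix_matrix_mult_def sum_2)

lemma diag_plus: "diag a b + diag c d = diag (a + c) (b + d)"
  by (simp add: diag_def vec_eq_iff forall_2)

lemma diag_1: "diag 1 1 = mat 1" and diag_mat: "mat c = diag c c"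
  by (simp_all add: diag_def vec_eq_iff forall_2 mat_def)

lemma adjoint_diag: "adjoint_mat (diag a b) = diag (cnj a) (cnj b)"
  by (simp add: diag_def vec_eq_iff forall_2 adjoint_mat_def)

lemma poly_eqI_eval: "p = q" if "\<And>x. poly p x = poly q x" for p q :: "complex poly"
  using that by (simp add: poly_eq_poly_eq_iff[symmetric] fun_eq_iff)

lemma const_mpoly_mult: "const_mpoly (A ** B) = const_mpoly A ** const_mpoly B"
  by (simp add: const_mpoly_def matrix_matrix_mult_def vec_eq_iff sum_2 forall_2)

lemma const_mpoly_add: "const_mpoly (X + Y) = const_mpoly X + const_mpoly Y"
  by (simp add: const_mpoly_def vec_eq_iff)

lemma const_mpoly_0 [simp]: "const_mpoly 0 = 0"
  by (simp add: const_mpoly_def vec_eq_iff)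

lemma const_mpoly_mat: "const_mpoly (mat c) = mat [:c:]"
  by (simp add: const_mpoly_def vec_eq_iff mat_def)

lemma mat_poly_nonzero: "p \<noteq> 0 \<Longrightarrow> mat p \<noteq> (0 :: mpoly)"
  by (auto simp: vec_eq_iff mat_def)

lemma mpoly_coeff_const_mult: "mpoly_coeff (const_mpoly C ** P) k = C ** mpoly_coeff P k"
  by (simp add: mpoly_coeff_def const_mpoly_def matrix_matrix_mult_def vec_eq_iff sum_2)

lemma mpoly_coeff_diff: "mpoly_coeff (P - Q) k = mpoly_coeff P k - mpoly_coeff Q k"
  by (simp add: mpoly_coeff_def vec_eq_iff)

lemma mpoly_coeff_eventually_0: "\<exists>n. \<forall>k\<ge>n. mpoly_coeff P k = 0"
proof -
  define n where "n = Suc (Max (range (\<lambda>(i, j). degree (P $ i $ j))))"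
  have "degree (P $ i $ j) < n" for i j
    unfolding n_def less_Suc_eq_le by (rule Max_ge) (auto intro: image_eqI[of _ _ "(i, j)"])
  then have "coeff (P $ i $ j) k = 0" if "k \<ge> n" for i j k
    using that by (meson coeff_eq_0 order_less_le_trans)
  then show ?thesis
    by (intro exI[of _ n]) (auto simp: mpoly_coeff_def vec_eq_iff)
qed

lemma mpoly_eq_0_iff: "P = 0 \<longleftrightarrow> (\<forall>k. mpoly_coeff P k = 0)"
  by (auto simp: mpoly_coeff_def vec_eq_iff poly_eq_iff)

lemma monic_expansion:
  assumes R: "\<And>k. monic_of_degree k (R k)" and X: "\<forall>k\<ge>n. mpoly_coeff X k = 0"
  shows "\<exists>C. X = (\<Sum>k<n. const_mpoly (C k) ** R k)"
  using X
proof (induction n arbitrary: X)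
  case 0
  then show ?case by (simp add: mpoly_eq_0_iff)
next
  case (Suc n)
  define Y where "Y = X - const_mpoly (mpoly_coeff X n) ** R n"
  have "mpoly_coeff Y k = 0" if "k \<ge> n" for k
    using that Suc.prems R[of n]
    by (cases "k = n") (auto simp: Y_def mpoly_coeff_diff mpoly_coeff_const_mult monic_of_degree_def)
  then obtain C where C: "Y = (\<Sum>k<n. const_mpoly (C k) ** R k)"
    using Suc.IH by blast
  have "X = (\<Sum>k<Suc n. const_mpoly ((C(n := mpoly_coeff X n)) k) ** R k)"
    using C by (simp add: Y_def algebra_simps)
  then show ?case by blast
qed

lemma monic_const_mult_cancel:
  assumes "monic_of_degree n P" and "const_mpoly A ** P = const_mpoly B ** P"
  shows "A = B"
  using arg_cong[OF assms(2), of "\<lambda>Q. mpoly_coeff Q n"] assms(1)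
  by (simp add: mpoly_coeff_const_mult monic_of_degree_def)

lemma mpoly_deriv_add: "mpoly_deriv (P + Q) = mpoly_deriv P + mpoly_deriv Q"
  by (simp add: mpoly_deriv_def vec_eq_iff pderiv_add)

lemma mpoly_deriv_mult: "mpoly_deriv (P ** Q) = mpoly_deriv P ** Q + P ** mpoly_deriv Q"
  by (simp add: mpoly_deriv_def vec_eq_iff matrix_matrix_mult_def sum_2 pderiv_add pderiv_mult
      algebra_simps)

lemma mpoly_deriv_const_mult:
  "mpoly_deriv (const_mpoly C ** P) = const_mpoly C ** mpoly_deriv P"
  by (simp add: mpoly_deriv_def const_mpoly_def vec_eq_iff matrix_matrix_mult_def sum_2 pderiv_add
      pderiv_smult)

lemma mpoly_deriv_mat: "mpoly_deriv (mat p) = mat (pderiv p)"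
  by (simp add: mpoly_deriv_def mat_def vec_eq_iff)

section \<open>Differential operators and their leading coefficients\<close>

text \<open>
  An operator acting from the right commutes with constant matrices multiplied from the left; this is
  the only linearity that survives noncommutativity.
\<close>

definition left_linear :: "mop \<Rightarrow> bool" where
  "left_linear D \<longleftrightarrow> (\<forall>P Q. D (P + Q) = D P + D Q) \<and>
     (\<forall>C P. D (const_mpoly C ** P) = const_mpoly C ** D P)"

lemma left_linear_add: "left_linear D \<Longrightarrow> D (P + Q) = D P + D Q"
  and left_linear_const: "left_linear D \<Longrightarrow> D (const_mpoly C ** P) = const_mpoly C ** D P"
  by (auto simp: left_linear_def)

lemma left_linear_0: "left_linear D \<Longrightarrow> D 0 = 0"
  using left_linear_const[of D 0 0] by simp

lemma left_linear_sum: "left_linear D \<Longrightarrow> D (\<Sum>k<n. f k) = (\<Sum>k<n. D (f k))" for n :: nat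
  by (induction n) (auto simp: left_linear_0 left_linear_add)

text \<open>
  All identities between operators below come from here: constant multiples of a monic sequence span
  the matrix polynomials, so it is enough to compare eigenvalues on orthogonal polynomials.
\<close>

lemma left_linear_ext:
  assumes D: "left_linear D" and E: "left_linear E" and R: "\<And>k. monic_of_degree k (R k)"
    and eq: "\<And>n. D (R n) = E (R n)"
  shows "D = E"
proof
  fix P
  obtain n C where "P = (\<Sum>k<(n::nat). const_mpoly (C k) ** R k)"
    using mpoly_coeff_eventually_0[of P] monic_expansion[OF R] by metis
  then show "D P = E P"
    by (simp add: left_linear_sum D E left_linear_const eq)
qed

lemma left_linear_op_mult: "left_linear D \<Longrightarrow> left_linear E \<Longrightarrow> left_linear (D \<odot>\<^sub>o E)"
  by (simp add: left_linear_def op_mult_def)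

lemma diffop_Nil [simp]: "diffop [] P = 0"
  by (simp add: diffop_def)

lemma diffop_Cons [simp]: "diffop (F # Fs) P = P ** F + diffop Fs (mpoly_deriv P)"
  by (simp add: diffop_def sum.lessThan_Suc_shift funpow_swap1 del: sum.lessThan_Suc)

lemma left_linear_diffop: "left_linear (diffop Fs)"
  by (induction Fs)
    (auto simp: left_linear_def matrix_add_rdistrib matrix_add_ldistrib matrix_mul_assoc
      mpoly_deriv_add mpoly_deriv_const_mult algebra_simps)

lemma left_linear_diffops: "D \<in> diffops \<Longrightarrow> left_linear D"
  by (auto simp: diffops_def left_linear_diffop)

lemmas diffops_const = left_linear_const[OF left_linear_diffops]

text \<open>
  The symbol at order \<open>m\<close> may be zero, so an operator has one at every order from its own on; orders
  are bounded by showing that a symbol vanishes.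
\<close>

definition has_symbol :: "nat \<Rightarrow> mpoly \<Rightarrow> mop \<Rightarrow> bool" where
  "has_symbol m G D \<longleftrightarrow> (\<exists>Fs. length Fs = m \<and> D = diffop (Fs @ [G]))"

lemma has_symbol_diffops: "has_symbol m G D \<Longrightarrow> D \<in> diffops"
  by (auto simp: has_symbol_def diffops_def)

lemma diffops_has_symbol:
  assumes "D \<in> diffops"
  obtains m G where "has_symbol m G D"
proof -
  obtain Fs where Fs: "D = diffop Fs" using assms by (auto simp: diffops_def)
  show ?thesis
  proof (cases Fs rule: rev_cases)
    case Nil
    have "has_symbol 0 0 D" unfolding has_symbol_def
      by (intro exI[of _ "[]"]) (auto simp: Fs Nil fun_eq_iff)
    then show ?thesis by (rule that)
  next
    case (snoc Gs G)
    then have "has_symbol (length Gs) G D" by (auto simp: has_symbol_def Fs)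
    then show ?thesis by (rule that)
  qed
qed

lemma has_symbol_0_iff: "has_symbol 0 G D \<longleftrightarrow> D = (\<lambda>P. P ** G)"
  by (auto simp: has_symbol_def fun_eq_iff)

lemma has_symbol_Suc_iff:
  "has_symbol (Suc m) G D \<longleftrightarrow> (\<exists>F E. has_symbol m G E \<and> D = (\<lambda>P. P ** F + E (mpoly_deriv P)))"
proof
  assume "has_symbol (Suc m) G D"
  then obtain Fs where "length Fs = Suc m" and D: "D = diffop (Fs @ [G])"
    by (auto simp: has_symbol_def)
  then obtain F Gs where "Fs = F # Gs" "length Gs = m" by (metis length_Suc_conv)
  then show "\<exists>F E. has_symbol m G E \<and> D = (\<lambda>P. P ** F + E (mpoly_deriv P))"
    by (intro exI[of _ F] exI[of _ "diffop (Gs @ [G])"]) (auto simp: has_symbol_def D fun_eq_iff)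
next
  assume "\<exists>F E. has_symbol m G E \<and> D = (\<lambda>P. P ** F + E (mpoly_deriv P))"
  then obtain F Fs where "length Fs = m" "D = (\<lambda>P. P ** F + diffop (Fs @ [G]) (mpoly_deriv P))"
    by (auto simp: has_symbol_def)
  then show "has_symbol (Suc m) G D"
    unfolding has_symbol_def by (intro exI[of _ "F # Fs"]) (auto simp: fun_eq_iff)
qed

lemma has_symbol_Suc_0: "has_symbol m G D \<Longrightarrow> has_symbol (Suc m) 0 D"
proof (induction m arbitrary: G D)
  case 0
  then show ?case
    by (auto simp: has_symbol_Suc_iff has_symbol_0_iff)
next
  case (Suc m)
  then obtain F E where "has_symbol m G E" and D: "D = (\<lambda>P. P ** F + E (mpoly_deriv P))"
    by (auto simp: has_symbol_Suc_iff)
  then have "has_symbol (Suc m) 0 E" using Suc.IH by blast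
  then show ?case
    unfolding has_symbol_Suc_iff[of "Suc m"] D by blast
qed

lemma has_symbol_less:
  assumes "has_symbol m G D" and "m < k"
  shows "has_symbol k 0 D"
  using assms(2)
proof (induction k)
  case (Suc k)
  then show ?case
    using assms(1) has_symbol_Suc_0 less_Suc_eq by metis
qed simp

lemma has_symbol_mono:
  assumes "has_symbol m G D" and "m \<le> k"
  obtains H where "has_symbol k H D"
  using assms has_symbol_less by (metis order_le_less)

lemma has_symbol_drop:
  assumes "has_symbol (Suc m) 0 D"
  obtains H where "has_symbol m H D"
proof -
  obtain Fs where Fs: "length Fs = Suc m" "D = diffop (Fs @ [0])"
    using assms by (auto simp: has_symbol_def)
  have "diffop (Fs @ [0]) P = diffop Fs P" for P
    by (induction Fs arbitrary: P) auto
  then have "D = diffop (butlast Fs @ [last Fs])"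
    using Fs by (metis append_butlast_last_id ext list.size(3) nat.distinct(1))
  then have "has_symbol m (last Fs) D"
    unfolding has_symbol_def using Fs(1) by (intro exI[of _ "butlast Fs"]) simp
  then show ?thesis by (rule that)
qed

lemma has_symbol_add:
  assumes "has_symbol m G D" and "has_symbol m H E"
  shows "has_symbol m (G + H) (D \<oplus>\<^sub>o E)"
  using assms
proof (induction m arbitrary: D E)
  case 0
  then show ?case by (simp add: has_symbol_0_iff op_add_def matrix_add_ldistrib)
next
  case (Suc m)
  obtain F D' where D: "has_symbol m G D'" "D = (\<lambda>P. P ** F + D' (mpoly_deriv P))"
    using Suc.prems has_symbol_Suc_iff by blast
  obtain F' E' where E: "has_symbol m H E'" "E = (\<lambda>P. P ** F' + E' (mpoly_deriv P))"
    using Suc.prems has_symbol_Suc_iff by blast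
  have "D \<oplus>\<^sub>o E = (\<lambda>P. P ** (F + F') + (D' \<oplus>\<^sub>o E') (mpoly_deriv P))"
    by (auto simp: D E op_add_def matrix_add_ldistrib)
  then show ?case
    using Suc.IH[OF D(1) E(1)] has_symbol_Suc_iff by blast
qed

lemma has_symbol_mult_matrix:
  assumes "has_symbol m G D"
  shows "has_symbol m (G ** H) (\<lambda>P. D P ** H)"
  using assms
proof (induction m arbitrary: D)
  case 0
  then show ?case by (simp add: has_symbol_0_iff matrix_mul_assoc)
next
  case (Suc m)
  then obtain F E where E: "has_symbol m G E" and D: "D = (\<lambda>P. P ** F + E (mpoly_deriv P))"
    by (auto simp: has_symbol_Suc_iff)
  show ?case
    unfolding has_symbol_Suc_iff D
    by (intro exI[of _ "F ** H"] exI[of _ "\<lambda>P. E P ** H"])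
      (auto simp: Suc.IH[OF E] matrix_add_rdistrib matrix_mul_assoc)
qed

lemma has_symbol_deriv:
  assumes "has_symbol m G D"
  shows "has_symbol (Suc m) G (\<lambda>P. mpoly_deriv (D P))"
  using assms
proof (induction m arbitrary: D)
  case 0
  then show ?case unfolding has_symbol_Suc_iff
    by (intro exI[of _ "mpoly_deriv G"] exI[of _ "\<lambda>P. P ** G"])
      (auto simp: has_symbol_0_iff mpoly_deriv_mult algebra_simps)
next
  case (Suc m)
  then obtain F E where E: "has_symbol m G E" and D: "D = (\<lambda>P. P ** F + E (mpoly_deriv P))"
    by (auto simp: has_symbol_Suc_iff)
  have "has_symbol (Suc m) (0 + G) ((\<lambda>P. P ** F) \<oplus>\<^sub>o (\<lambda>P. mpoly_deriv (E P)))"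
    by (intro has_symbol_add Suc.IH E has_symbol_less[of 0 F]) (auto simp: has_symbol_0_iff)
  then show ?case
    unfolding has_symbol_Suc_iff[of "Suc m"]
    by (intro exI[of _ "mpoly_deriv F"] exI[of _ "(\<lambda>P. P ** F) \<oplus>\<^sub>o (\<lambda>P. mpoly_deriv (E P))"])
      (auto simp: D op_add_def mpoly_deriv_add mpoly_deriv_mult algebra_simps)
qed

text \<open>
  By the Leibniz rule the leading coefficients multiply, in the order of application. The induction
  removes the term of order zero from the second factor and moves one derivative to the first.
\<close>

lemma has_symbol_op_mult:
  assumes "has_symbol m G D" and "has_symbol k H E"
  shows "has_symbol (m + k) (G ** H) (D \<odot>\<^sub>o E)"
  using assms
proof (induction k arbitrary: m D E)
  case 0
  then show ?case using has_symbol_mult_matrix by (auto simp: has_symbol_0_iff op_mult_def)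
next
  case (Suc k)
  then obtain F E' where E': "has_symbol k H E'" and E: "E = (\<lambda>P. P ** F + E' (mpoly_deriv P))"
    by (auto simp: has_symbol_Suc_iff)
  have "has_symbol (m + Suc k) (0 + G ** H)
      ((\<lambda>P. D P ** F) \<oplus>\<^sub>o ((\<lambda>P. mpoly_deriv (D P)) \<odot>\<^sub>o E'))"
    using Suc.IH[OF has_symbol_deriv[OF Suc.prems(1)] E']
    by (intro has_symbol_add has_symbol_less[OF has_symbol_mult_matrix[OF Suc.prems(1)]]) auto
  then show ?case by (simp add: E op_add_def op_mult_def)
qed

text \<open>
  The powers of \<open>x\<close> recover the coefficients one at a time: on 1 only the coefficient of order zero
  acts, and differentiating a power shifts the list of coefficients by one.
\<close>

lemma diffop_faithful:
  assumes "\<And>k. diffop Fs (mat ([:0, 1:] ^ k)) = 0"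
  shows "\<forall>F\<in>set Fs. F = 0"
  using assms
proof (induction Fs)
  case (Cons F Fs)
  have deriv: "mpoly_deriv (mat ([:0, 1:] ^ Suc k)) =
      const_mpoly (mat (of_nat (Suc k))) ** mat ([:0, 1:] ^ k)" for k
    unfolding const_mpoly_mat vec_eq_iff mat_mult_entry
    by (simp add: mpoly_deriv_def pderiv_power_Suc pderiv_pCons mat_def
        del: power_Suc of_nat_Suc)
  have "mpoly_deriv (mat 1) = 0"
    by (simp add: mpoly_deriv_def mat_def vec_eq_iff)
  then have F: "F = 0"
    using Cons.prems[of 0] left_linear_0[OF left_linear_diffop, of Fs] by simp
  have "diffop Fs (mat ([:0, 1:] ^ k)) = 0" for k
  proof -
    have "const_mpoly (mat (of_nat (Suc k))) ** diffop Fs (mat ([:0, 1:] ^ k)) = 0"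
      using Cons.prems[of "Suc k"] unfolding diffop_Cons deriv
      by (simp add: F left_linear_const[OF left_linear_diffop])
    then show ?thesis
      by (simp add: vec_eq_iff const_mpoly_mat mat_mult_entry)
        (metis of_nat_Suc of_nat_eq_0_iff nat.distinct(1) pCons_eq_0_iff)
  qed
  then show ?case using F Cons.IH by auto
qed simp

lemma has_symbol_unique:
  assumes "has_symbol m G D" and "has_symbol m H D"
  shows "G = H"
proof -
  have "has_symbol m (H ** mat (- 1)) (\<lambda>P. D P ** mat (- 1))"
    using assms(2) by (rule has_symbol_mult_matrix)
  then have "has_symbol m (G + H ** mat (- 1)) (D \<oplus>\<^sub>o (\<lambda>P. D P ** mat (- 1)))"
    by (rule has_symbol_add[OF assms(1)])
  moreover have "D \<oplus>\<^sub>o (\<lambda>P. D P ** mat (- 1)) = (\<lambda>P. 0)"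
    by (simp add: op_add_def vec_eq_iff mult_mat_entry fun_eq_iff)
  ultimately obtain Fs where "diffop (Fs @ [G + H ** mat (- 1)]) = (\<lambda>P. 0)"
    by (auto simp: has_symbol_def)
  then have "G + H ** mat (- 1) = 0"
    using diffop_faithful[of "Fs @ [G + H ** mat (- 1)]"] by simp
  then show ?thesis
    by (simp add: vec_eq_iff mult_mat_entry)
qed

lemma op_order_eqI:
  assumes "has_symbol m G D" and "G \<noteq> 0"
  shows "op_order D = m"
  unfolding op_order_def
proof (rule Least_equality)
  show "\<exists>Fs. length Fs = Suc m \<and> D = diffop Fs"
    using assms(1) unfolding has_symbol_def by (metis length_append_singleton)
  fix k assume "\<exists>Fs. length Fs = Suc k \<and> D = diffop Fs"
  then obtain Fs where "length Fs = Suc k" and D: "D = diffop Fs" by blast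
  then obtain Gs H where "Fs = Gs @ [H]" "length Gs = k"
    by (metis length_Suc_conv_rev)
  then have "has_symbol k H D" by (auto simp: has_symbol_def D)
  then show "m \<le> k"
    using has_symbol_less has_symbol_unique assms by (metis not_le)
qed

lemma diffops_mult: "D \<in> diffops \<Longrightarrow> E \<in> diffops \<Longrightarrow> D \<odot>\<^sub>o E \<in> diffops"
  by (meson diffops_has_symbol has_symbol_op_mult has_symbol_diffops)

lemma diffops_add:
  assumes "D \<in> diffops" "E \<in> diffops"
  shows "D \<oplus>\<^sub>o E \<in> diffops"
proof -
  obtain m G k H where "has_symbol m G D" "has_symbol k H E"
    using assms diffops_has_symbol by metis
  then obtain G' H' where "has_symbol (max m k) G' D" "has_symbol (max m k) H' E"
    using has_symbol_mono by (metis max.cobounded1 max.cobounded2)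
  then show ?thesis using has_symbol_add has_symbol_diffops by blast
qed

lemma diffop_in_diffops: "diffop Fs \<in> diffops"
  by (simp add: diffops_def)

definition matrix_op :: "cmatrix \<Rightarrow> mop" where
  "matrix_op X = diffop [const_mpoly X]"

lemma matrix_op_diffops: "matrix_op X \<in> diffops"
  by (simp add: matrix_op_def diffop_in_diffops)

section \<open>Operators with scalar eigenvalues\<close>

text \<open>
  Here \<open>l n\<close> is the eigenvalue of a reference operator on \<open>P n\<close>, and \<open>q\<close> is a function of that operator:
  \<open>D\<close> behaves on the sequence \<open>P\<close> as \<open>q\<close> of the reference operator would. For monic \<open>P\<close> and injective \<open>l\<close> the
  polynomial and the operator determine each other, and sums and products correspond; questions about
  central operators thereby become questions about polynomials.
\<close>

definition acts_by :: "(nat \<Rightarrow> complex) \<Rightarrow> (nat \<Rightarrow> mpoly) \<Rightarrow> complex poly \<Rightarrow> mop \<Rightarrow> bool" where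
  "acts_by l P q D \<longleftrightarrow> D \<in> diffops \<and> (\<forall>n. D (P n) = const_mpoly (mat (poly q (l n))) ** P n)"

lemma acts_by_op_unique:
  assumes "\<And>n. monic_of_degree n (P n)" and "acts_by l P q D" and "acts_by l P q E"
  shows "D = E"
proof (rule left_linear_ext[OF _ _ assms(1)])
  show "left_linear D" "left_linear E"
    using assms(2,3) by (simp_all add: acts_by_def left_linear_diffops)
  show "D (P n) = E (P n)" for n
    using assms(2,3) unfolding acts_by_def by metis
qed

lemma poly_eqI_infinite:
  assumes "inj (l :: nat \<Rightarrow> complex)" and "\<And>n. poly p (l n) = poly q (l n)"
  shows "p = q"
proof (rule ccontr)
  assume "p \<noteq> q"
  then have "finite {x. poly (p - q) x = 0}" by (intro poly_roots_finite) simp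
  moreover have "range l \<subseteq> {x. poly (p - q) x = 0}" using assms(2) by auto
  ultimately show False using range_inj_infinite[OF assms(1)] finite_subset by blast
qed

lemma acts_by_poly_unique:
  assumes "inj l" and P: "\<And>n. monic_of_degree n (P n)" and "acts_by l P q D" and "acts_by l P r D"
  shows "q = r"
proof (rule poly_eqI_infinite[OF assms(1)])
  fix n
  have "mat (poly q (l n)) = (mat (poly r (l n)) :: cmatrix)"
    using assms(3,4) unfolding acts_by_def by (intro monic_const_mult_cancel[OF P[of n]]) metis
  from arg_cong[OF this, of "\<lambda>M. M $ 1 $ 1"] show "poly q (l n) = poly r (l n)"
    by (simp add: mat_def)
qed

lemma acts_by_add: "acts_by l P q D \<Longrightarrow> acts_by l P r E \<Longrightarrow> acts_by l P (q + r) (D \<oplus>\<^sub>o E)"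
proof -
  have "const_mpoly (mat (a + b)) = const_mpoly (mat a) + const_mpoly (mat b)" for a b
    by (simp add: const_mpoly_def vec_eq_iff mat_def)
  moreover assume "acts_by l P q D" "acts_by l P r E"
  ultimately show ?thesis
    unfolding acts_by_def by (intro conjI diffops_add) (auto simp: op_add_def matrix_add_rdistrib)
qed

lemma acts_by_mult: "acts_by l P q D \<Longrightarrow> acts_by l P r E \<Longrightarrow> acts_by l P (q * r) (D \<odot>\<^sub>o E)"
  unfolding acts_by_def
  by (intro conjI diffops_mult)
    (auto simp: op_mult_def left_linear_const[OF left_linear_diffops]
      matrix_mul_assoc const_mpoly_mult[symmetric] mat_mult_mat)

lemma op_scalar_apply: "op_scalar c P = const_mpoly (mat c) ** P"
  by (simp add: op_scalar_def const_mpoly_mat mat_commutes)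

lemma acts_by_scalar: "acts_by l P [:c:] (op_scalar c)"
  by (simp add: acts_by_def op_scalar_apply) (simp add: op_scalar_def diffop_in_diffops)

lemma op_scalar_0: "op_scalar 0 = op_zero"
  by (simp add: op_scalar_apply fun_eq_iff op_zero_def const_mpoly_mat vec_eq_iff mat_mult_entry)

lemma generated_algebra_acts_by:
  assumes "D \<in> generated_algebra G" and "\<And>D. D \<in> G \<Longrightarrow> \<exists>q. acts_by l P q D"
  shows "\<exists>q. acts_by l P q D"
  using assms(1)
proof induction
  case (gen D)
  then show ?case by (rule assms(2))
next
  case zero
  then show ?case using acts_by_scalar[of l P 0] unfolding op_scalar_0 by blast
next
  case (add D E)
  then show ?case using acts_by_add by blast
next
  case (scale D c)
  then show ?case using acts_by_mult[OF acts_by_scalar] by blast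
next
  case (mult D E)
  then show ?case using acts_by_mult by blast
qed

section \<open>The Jacobi functional\<close>

text \<open>
  This scalar functional carries all the analysis. Matrix inner products are values of it at entries of
  polynomial matrices, so that integration by parts and positivity are needed for it alone.
\<close>

definition jacobi_functional :: "real \<Rightarrow> real \<Rightarrow> complex poly \<Rightarrow> complex" where
  "jacobi_functional a b p = (LINT x:{-1<..<1}|lborel.
     complex_of_real ((1 - x) powr a * (1 + x) powr b) * poly p (complex_of_real x))"

lemma jacobi_weight_integrable:
  fixes a b :: real
  assumes "a > -1" and "b > -1"
  shows "set_integrable lborel {-1<..<1} (\<lambda>x. (1 - x) powr a * (1 + x) powr b)"
proof -
  let ?f = "\<lambda>t::real. indicator {0..1} t *\<^sub>R (t powr b * (1 - t) powr a)"
  have "integrable lborel ?f"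
    using integrable_Beta[of "b + 1" "a + 1"] assms by (simp add: set_integrable_def)
  \<comment> \<open>Substitute \<open>t = (1 + x) / 2\<close> in the Beta integral.\<close>
  then have "integrable lborel (\<lambda>x. ?f (1/2 + (1/2) * x))"
    using lborel_integrable_real_affine[of ?f "1/2" "1/2"] by simp
  moreover have "?f (1/2 + (1/2) * x) =
      indicator {-1..1} x *\<^sub>R ((1/2) powr (a + b) * ((1 - x) powr a * (1 + x) powr b))" for x
  proof (cases "x \<in> {-1..1}")
    case True
    then have "((1/2) * (1 + x)) powr b = (1/2) powr b * (1 + x) powr b"
      and "((1/2) * (1 - x)) powr a = (1/2) powr a * (1 - x) powr a"
      by (intro powr_mult; simp)+
    moreover have "1/2 + (1/2) * x = (1/2) * (1 + x)" "1 - (1/2) * (1 + x) = (1/2) * (1 - x)"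
      by (simp_all add: field_simps)
    ultimately show ?thesis using True by (simp only:) (auto simp: indicator_def powr_add)
  qed (auto simp: indicator_def)
  ultimately have "set_integrable lborel {-1..1}
      (\<lambda>x. (1/2) powr (a + b) * ((1 - x) powr a * (1 + x) powr b))"
    by (simp add: set_integrable_def)
  then have "set_integrable lborel {-1..1} (\<lambda>x. (1 - x) powr a * (1 + x) powr b)"
    by (subst (asm) set_integrable_mult_right_iff) auto
  then show ?thesis by (rule set_integrable_subset) auto
qed

lemma jacobi_integrable:
  fixes a b :: real
  assumes "a > -1" and "b > -1"
  shows "set_integrable lborel {-1<..<1}
    (\<lambda>x. complex_of_real ((1 - x) powr a * (1 + x) powr b) * poly p (complex_of_real x))"
proof -
  have cont: "continuous_on X (\<lambda>x. poly p (complex_of_real x))" for X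
    by (intro continuous_intros)
  have "compact ((\<lambda>x. poly p (complex_of_real x)) ` {-1..1})"
    by (intro compact_continuous_image cont) auto
  then obtain K where "\<forall>y\<in>(\<lambda>x. poly p (complex_of_real x)) ` {-1..1}. norm y \<le> K"
    using compact_imp_bounded bounded_iff by metis
  then have K: "norm (poly p (complex_of_real x)) \<le> K" if "x \<in> {-1..1}" for x
    using that by blast
  have [measurable]: "(\<lambda>x. poly p (complex_of_real x)) \<in> borel_measurable borel"
    by (rule borel_measurable_continuous_onI[OF cont])
  show ?thesis
  proof (rule set_integrable_bound)
    show "set_integrable lborel {-1<..<1} (\<lambda>x. K * ((1 - x) powr a * (1 + x) powr b))"
      by (intro set_integrable_mult_right jacobi_weight_integrable assms)
    show "set_borel_measurable lborel {-1<..<1}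
        (\<lambda>x. complex_of_real ((1 - x) powr a * (1 + x) powr b) * poly p (complex_of_real x))"
      unfolding set_borel_measurable_def by measurable
    show "AE x in lborel. x \<in> {-1<..<1} \<longrightarrow>
      norm (complex_of_real ((1 - x) powr a * (1 + x) powr b) * poly p (complex_of_real x))
        \<le> norm (K * ((1 - x) powr a * (1 + x) powr b))"
    proof (intro AE_I2 impI)
      fix x :: real assume "x \<in> {-1<..<1}"
      then have "norm (poly p (complex_of_real x)) \<le> \<bar>K\<bar>"
        using K[of x] by auto
      then show "norm (complex_of_real ((1 - x) powr a * (1 + x) powr b) * poly p (complex_of_real x))
          \<le> norm (K * ((1 - x) powr a * (1 + x) powr b))"
        unfolding norm_mult norm_of_real real_norm_def abs_mult
        by (subst mult.commute) (intro mult_right_mono; simp)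
    qed
  qed
qed

lemma jacobi_functional_add:
  assumes "a > -1" and "b > -1"
  shows "jacobi_functional a b (p + q) = jacobi_functional a b p + jacobi_functional a b q"
proof -
  have "jacobi_functional a b (p + q) = (LINT x:{-1<..<1}|lborel.
     complex_of_real ((1 - x) powr a * (1 + x) powr b) * poly p (complex_of_real x) +
     complex_of_real ((1 - x) powr a * (1 + x) powr b) * poly q (complex_of_real x))"
    unfolding jacobi_functional_def by (simp add: algebra_simps)
  then show ?thesis
    unfolding jacobi_functional_def using jacobi_integrable[OF assms] by (subst (asm) set_integral_add) auto
qed

lemma jacobi_functional_smult: "jacobi_functional a b (smult c p) = c * jacobi_functional a b p"
  unfolding jacobi_functional_def set_integral_mult_right[symmetric] by (simp add: algebra_simps)

text \<open>
  The integrand is the derivative of \<open>(1 - x)\<^bsup>a + 1\<^esup> (1 + x)\<^bsup>b + 1\<^esup> f\<close>.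
\<close>

lemma jacobi_functional_parts:
  fixes a b :: real
  assumes ab: "a > -1" "b > -1"
  shows "jacobi_functional a b ([:1, 0, -1:] * pderiv f
           + [:complex_of_real (b - a), - complex_of_real (a + b + 2):] * f) = 0"
    (is "jacobi_functional a b ?g = 0")
proof -
  let ?w = "\<lambda>x. (1 - x) powr a * (1 + x) powr b"
  let ?F = "\<lambda>x. ((1 - x) powr (a + 1) * (1 + x) powr (b + 1)) *\<^sub>R poly f (complex_of_real x)"
  let ?F' = "\<lambda>x. complex_of_real (?w x) * poly ?g (complex_of_real x)"
  \<comment> \<open>The antiderivative vanishes at both endpoints because its exponents are positive.\<close>
  have "(?F has_vector_derivative ?F' x) (at x)" if x: "x \<in> {-1<..<1}" for x
  proof -
    have "((\<lambda>x. (1 - x) powr (a + 1)) has_real_derivative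
        (a + 1) * (1 - x) powr (a + 1 - of_nat 1) * (-1)) (at x)"
      using x by (intro DERIV_fun_powr) (auto intro!: derivative_eq_intros)
    moreover have "((\<lambda>x. (1 + x) powr (b + 1)) has_real_derivative
        (b + 1) * (1 + x) powr (b + 1 - of_nat 1) * 1) (at x)"
      using x by (intro DERIV_fun_powr) (auto intro!: derivative_eq_intros)
    ultimately have w: "((\<lambda>x. (1 - x) powr (a + 1) * (1 + x) powr (b + 1)) has_real_derivative
        ?w x * ((b + 1) * (1 - x) - (a + 1) * (1 + x))) (at x)"
      using x by (intro DERIV_cong[OF DERIV_mult]) (auto simp: powr_add algebra_simps)
    have p: "((\<lambda>x. poly f (complex_of_real x)) has_vector_derivative
        poly (pderiv f) (complex_of_real x)) (at x)"
      using has_vector_derivative_real_field[OF poly_DERIV[of f "complex_of_real x"]] by simp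
    have e: "(1 - x) powr (a + 1) * (1 + x) powr (b + 1) = ?w x * (1 - x\<^sup>2)"
      using x by (simp add: powr_add power2_eq_square algebra_simps)
    show ?thesis
      by (rule has_vector_derivative_eq_rhs[OF has_vector_derivative_scaleR[OF w p]])
        (simp only: e scaleR_conv_of_real, simp add: algebra_simps power2_eq_square)
  qed
  moreover have "continuous_on {-1..1} ?F"
    using ab by (intro continuous_intros continuous_on_powr') auto
  ultimately have "(?F' has_integral ?F 1 - ?F (-1)) {-1..1}"
    by (intro fundamental_theorem_of_calculus_interior) auto
  then have "(?F' has_integral 0) {-1<..<1}"
    unfolding has_integral_Icc_iff_Ioo by simp
  then show ?thesis
    unfolding jacobi_functional_def set_borel_integral_eq_integral(2)[OF jacobi_integrable[OF ab]]
    by (rule integral_unique)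
qed

text \<open>
  A polynomial with real coefficients has \<open>p\<^sup>2 = |p|\<^sup>2\<close> on the real line, and it vanishes at finitely many
  points only.
\<close>

lemma jacobi_functional_square_nonzero:
  fixes a b :: real
  assumes ab: "a > -1" "b > -1" and p: "p \<noteq> 0" and real: "map_poly cnj p = p"
  shows "jacobi_functional a b (p * p) \<noteq> 0"
proof
  assume 0: "jacobi_functional a b (p * p) = 0"
  let ?w = "\<lambda>x. (1 - x) powr a * (1 + x) powr b"
  have sq: "poly (p * p) (complex_of_real x) = complex_of_real ((norm (poly p (complex_of_real x)))\<^sup>2)" for x
  proof -
    have "cnj (poly p (complex_of_real x)) = poly p (complex_of_real x)"
      using poly_cnj[of p "complex_of_real x"] real by simp
    then show ?thesis by (simp only: complex_norm_square poly_mult)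
  qed
  let ?f = "\<lambda>x. indicator {-1<..<1} x *\<^sub>R (?w x * (norm (poly p (complex_of_real x)))\<^sup>2)"
  have eq: "indicator {-1<..<1} x *\<^sub>R (complex_of_real (?w x) * poly (p * p) (complex_of_real x))
      = complex_of_real (?f x)" for x
    unfolding sq by (simp add: scaleR_conv_of_real)
  have int: "integrable lborel (\<lambda>x. complex_of_real (?f x))"
    using jacobi_integrable[OF ab, of "p * p"] unfolding set_integrable_def eq .
  then have int': "integrable lborel ?f"
    using integrable_Re[OF int] by simp
  have "integral\<^sup>L lborel ?f = 0"
    using 0 unfolding jacobi_functional_def set_lebesgue_integral_def eq integral_complex_of_real
    by (simp only: of_real_eq_0_iff)
  then have "AE x in lborel. ?f x = 0"
    using integral_nonneg_eq_0_iff_AE[OF int'] by auto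
  moreover have "AE x in lborel. x \<notin> complex_of_real -` {z. poly p z = 0}"
  proof -
    have "finite (complex_of_real -` {z. poly p z = 0})"
      using poly_roots_finite[OF p] finite_vimageI[of "{z. poly p z = 0}" complex_of_real]
      by (simp add: inj_on_def)
    then show ?thesis using finite_imp_null_set_lborel AE_not_in by blast
  qed
  ultimately have "AE x in lborel. x \<notin> {-1<..<(1::real)}"
  proof eventually_elim
    case (elim x)
    then show ?case by (auto simp: indicator_def)
  qed
  then have "{-1<..<(1::real)} \<in> null_sets lborel"
    by (simp add: AE_iff_null_sets)
  then show False by (simp add: null_sets_def)
qed

section \<open>Eigenpolynomials of the scalar Jacobi operator\<close>

definition jacobi_op :: "real \<Rightarrow> real \<Rightarrow> complex poly \<Rightarrow> complex poly" where
  "jacobi_op \<alpha> \<beta> p = [:1, 0, -1:] * pderiv (pderiv p) + lin (\<beta> - \<alpha>) (- (\<alpha> + \<beta> + 4)) * pderiv p"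

definition jacobi_eigenvalue :: "real \<Rightarrow> real \<Rightarrow> nat \<Rightarrow> real" where
  "jacobi_eigenvalue \<alpha> \<beta> n = - real n * (real n + (\<alpha> + \<beta> + 3))"

lemma jacobi_eigenvalue_inj:
  assumes "\<alpha> > -1" "\<beta> > -1"
  shows "jacobi_eigenvalue \<alpha> \<beta> m = jacobi_eigenvalue \<alpha> \<beta> n \<longleftrightarrow> m = n"
proof
  assume "jacobi_eigenvalue \<alpha> \<beta> m = jacobi_eigenvalue \<alpha> \<beta> n"
  then have "(real m - real n) * (real m + real n + (\<alpha> + \<beta> + 3)) = 0"
    by (simp add: jacobi_eigenvalue_def algebra_simps)
  moreover have "real m + real n + (\<alpha> + \<beta> + 3) > 0" using assms by linarith
  ultimately show "m = n" by simp
qed simp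

text \<open>
  Taylor coefficients at 1 of the eigenpolynomial of degree \<open>n\<close> with value 1 there, that is, of the
  terminating hypergeometric series.
\<close>

primrec jacobi_taylor :: "real \<Rightarrow> real \<Rightarrow> nat \<Rightarrow> nat \<Rightarrow> real" where
  "jacobi_taylor \<alpha> \<beta> n 0 = 1"
| "jacobi_taylor \<alpha> \<beta> n (Suc j) = jacobi_taylor \<alpha> \<beta> n j *
     (jacobi_eigenvalue \<alpha> \<beta> j - jacobi_eigenvalue \<alpha> \<beta> n) / (2 * (real j + 1) * (real j + \<alpha> + 2))"

lemma jacobi_taylor_nonzero:
  assumes "\<alpha> > -1" "\<beta> > -1" "j \<le> n"
  shows "jacobi_taylor \<alpha> \<beta> n j \<noteq> 0"
  using assms(3)
proof (induction j)
  case (Suc j)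
  have "jacobi_eigenvalue \<alpha> \<beta> j \<noteq> jacobi_eigenvalue \<alpha> \<beta> n"
    using Suc.prems jacobi_eigenvalue_inj[OF assms(1,2)] by simp
  moreover have "real j + \<alpha> + 2 \<noteq> 0" "real j + 1 \<noteq> 0" using assms(1) by linarith+
  ultimately show ?case using Suc by simp
qed simp

lemma jacobi_op_add: "jacobi_op \<alpha> \<beta> (p + q) = jacobi_op \<alpha> \<beta> p + jacobi_op \<alpha> \<beta> q"
  by (simp add: jacobi_op_def pderiv_add algebra_simps)

lemma jacobi_op_smult: "jacobi_op \<alpha> \<beta> (smult c p) = smult c (jacobi_op \<alpha> \<beta> p)"
  by (simp add: jacobi_op_def pderiv_smult algebra_simps smult_add_right)

lemma jacobi_op_0: "jacobi_op \<alpha> \<beta> 0 = 0"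
  by (simp add: jacobi_op_def)

lemma smult_sum_lessThan: "smult c (\<Sum>j<n. f j) = (\<Sum>j<n. smult c (f j))" for n :: nat
  by (induction n) (auto simp: smult_add_right)

lemma jacobi_op_sum: "jacobi_op \<alpha> \<beta> (\<Sum>j<n. f j) = (\<Sum>j<n. jacobi_op \<alpha> \<beta> (f j))" for n :: nat
  by (induction n) (auto simp: jacobi_op_0 jacobi_op_add)

text \<open>
  In powers of \<open>x - 1\<close> the operator has only two diagonals, because 1 is a root of its leading
  coefficient. This is the origin of the two-term recursion for the Taylor coefficients.
\<close>

lemma jacobi_op_power:
  "jacobi_op \<alpha> \<beta> ([:-1, 1:] ^ j) = smult (of_real (jacobi_eigenvalue \<alpha> \<beta> j)) ([:-1, 1:] ^ j)
     - smult (of_real (2 * real j * (real j + \<alpha> + 1))) ([:-1, 1:] ^ (j - 1))"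
proof -
  consider "j = 0" | "j = 1" | k where "j = Suc (Suc k)"
    by (metis One_nat_def not0_implies_Suc)
  then show ?thesis
  proof cases
    case 3
    have d: "pderiv ([:-1, 1:] ^ Suc m) = smult (of_nat (Suc m)) ([:-1, 1:] ^ m :: complex poly)" for m
      by (simp add: pderiv_power_Suc pderiv_pCons del: power_Suc of_nat_Suc)
    show ?thesis unfolding 3 jacobi_op_def jacobi_eigenvalue_def lin_def
      by (rule poly_eqI_eval) (simp add: d pderiv_smult del: power_Suc, simp add: algebra_simps)
  qed (rule poly_eqI_eval, simp add: jacobi_op_def jacobi_eigenvalue_def lin_def pderiv_pCons
      algebra_simps)+
qed

lemma jacobi_eigenpoly_exists:
  assumes "\<alpha> > -1" "\<beta> > -1"
  shows "\<exists>p. degree p = n \<and> coeff p n = 1 \<and> map_poly cnj p = p \<and>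
    jacobi_op \<alpha> \<beta> p = smult (of_real (jacobi_eigenvalue \<alpha> \<beta> n)) p"
proof -
  let ?a = "\<lambda>j. complex_of_real (jacobi_taylor \<alpha> \<beta> n j)"
  let ?l = "\<lambda>j. complex_of_real (jacobi_eigenvalue \<alpha> \<beta> j)"
  let ?X = "[:-1, 1:] :: complex poly"
  define q where "q = (\<Sum>j<Suc n. smult (?a j) (?X ^ j))"
  define t where "t = (\<lambda>j. smult (?a j * of_real (2 * real j * (real j + \<alpha> + 1))) (?X ^ (j - 1)))"
  \<comment> \<open>Each term misses the eigenvalue equation by a difference of consecutive values of \<open>t\<close>.\<close>
  have step: "jacobi_op \<alpha> \<beta> (smult (?a j) (?X ^ j)) - smult (?l n) (smult (?a j) (?X ^ j))
      = t (Suc j) - t j" for j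
  proof -
    have nz: "real j + \<alpha> + 2 \<noteq> 0" "real j + 1 \<noteq> 0" using assms(1) by linarith+
    have "jacobi_taylor \<alpha> \<beta> n (Suc j) * (2 * real (Suc j) * (real (Suc j) + \<alpha> + 1)) =
      jacobi_taylor \<alpha> \<beta> n j * (jacobi_eigenvalue \<alpha> \<beta> j - jacobi_eigenvalue \<alpha> \<beta> n)"
    proof -
      have e: "2 * real (Suc j) * (real (Suc j) + \<alpha> + 1) = 2 * (real j + 1) * (real j + \<alpha> + 2)"
        by (simp add: algebra_simps)
      show ?thesis unfolding e using nz by simp
    qed
    then have "?a (Suc j) * of_real (2 * real (Suc j) * (real (Suc j) + \<alpha> + 1)) = ?a j * (?l j - ?l n)"
      by (simp only: of_real_mult[symmetric] of_real_diff[symmetric])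
    then have "t (Suc j) = smult (?a j * (?l j - ?l n)) (?X ^ j)"
      by (simp only: t_def diff_Suc_1)
    then show ?thesis
      unfolding jacobi_op_smult jacobi_op_power t_def
      by (simp add: smult_diff_right algebra_simps smult_diff_left)
  qed
  have "jacobi_op \<alpha> \<beta> q - smult (?l n) q = (\<Sum>j<Suc n. t (Suc j) - t j)"
    unfolding q_def jacobi_op_sum step[symmetric] sum_subtractf
    by (simp only: smult_sum_lessThan)
  also have "\<dots> = t (Suc n) - t 0"
    by (rule sum_lessThan_telescope)
  also have "\<dots> = 0" by (simp add: t_def)
  finally have eig: "jacobi_op \<alpha> \<beta> q = smult (?l n) q" by simp
  have an: "?a n \<noteq> 0" using jacobi_taylor_nonzero[OF assms, of n n] by simp
  have degX: "degree (?X ^ j) = j" for j by (simp add: degree_power_eq)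
  have coeff_small: "coeff (\<Sum>j<m. smult (?a j) (?X ^ j)) k = 0" if "k \<ge> m" for k m
    using that by (induction m) (auto simp: coeff_eq_0 degX)
  have qn: "coeff q n = ?a n"
    using coeff_small[of n n] lead_coeff_power[of ?X n] by (simp add: q_def degX)
  have "degree q \<le> n" using coeff_small[of "Suc n"] unfolding q_def by (intro degree_le) auto
  with qn an have degq: "degree q = n" using le_degree[of q n] by fastforce
  have cnjq: "map_poly cnj q = q"
    by (rule poly_eqI_eval) (simp add: q_def poly_sum)
  have cnjs: "map_poly cnj (smult (1 / ?a n) q) = smult (1 / ?a n) q"
  proof (rule poly_eqI_eval)
    fix x show "poly (map_poly cnj (smult (1 / ?a n) q)) x = poly (smult (1 / ?a n) q) x"
      using arg_cong[OF cnjq, of "\<lambda>p. poly p x"] by simp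
  qed
  show ?thesis
    by (rule exI[of _ "smult (1 / ?a n) q"])
      (use an degq qn eig cnjs in \<open>auto simp: jacobi_op_smult mult.commute\<close>)
qed

lemma jacobi_op_higher_pderiv:
  "(pderiv ^^ i) (jacobi_op \<alpha> \<beta> p) = [:1, 0, -1:] * (pderiv ^^ Suc (Suc i)) p
     + (lin (\<beta> - \<alpha>) (- (\<alpha> + \<beta> + 4)) - [:0, 2 * of_nat i:]) * (pderiv ^^ Suc i) p
     + smult (of_real (jacobi_eigenvalue \<alpha> \<beta> i)) ((pderiv ^^ i) p)"
proof (induction i)
  case 0
  then show ?case by (simp add: jacobi_op_def jacobi_eigenvalue_def)
next
  case (Suc i)
  define q where "q = (pderiv ^^ i) p"
  have "(pderiv ^^ Suc i) (jacobi_op \<alpha> \<beta> p) = pderiv ((pderiv ^^ i) (jacobi_op \<alpha> \<beta> p))" by simp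
  also have "\<dots> = [:1, 0, -1:] * pderiv (pderiv (pderiv q)) + pderiv [:1, 0, -1:] * pderiv (pderiv q)
     + (lin (\<beta> - \<alpha>) (- (\<alpha> + \<beta> + 4)) - [:0, 2 * of_nat i:]) * pderiv (pderiv q)
     + pderiv (lin (\<beta> - \<alpha>) (- (\<alpha> + \<beta> + 4)) - [:0, 2 * of_nat i:]) * pderiv q
     + smult (of_real (jacobi_eigenvalue \<alpha> \<beta> i)) (pderiv q)"
    unfolding Suc.IH q_def[symmetric] funpow.simps o_apply
    by (simp only: pderiv_add pderiv_mult pderiv_smult ac_simps)
  also have "\<dots> = [:1, 0, -1:] * pderiv (pderiv (pderiv q))
     + (lin (\<beta> - \<alpha>) (- (\<alpha> + \<beta> + 4)) - [:0, 2 * of_nat (Suc i):]) * pderiv (pderiv q)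
     + smult (of_real (jacobi_eigenvalue \<alpha> \<beta> (Suc i))) (pderiv q)"
    by (rule poly_eqI_eval)
      (simp add: lin_def pderiv_pCons pderiv_diff jacobi_eigenvalue_def algebra_simps)
  finally show ?case by (simp add: q_def)
qed

text \<open>
  The \<open>j\<close>-th derivative at 1 of an eigenfunction with value 1 at 1, as a polynomial in the eigenvalue.
\<close>

primrec deriv_ratio :: "real \<Rightarrow> real \<Rightarrow> nat \<Rightarrow> complex poly" where
  "deriv_ratio \<alpha> \<beta> 0 = 1"
| "deriv_ratio \<alpha> \<beta> (Suc i) = smult (of_real (- 1 / (2 * (\<alpha> + 2 + real i))))
     ([:- of_real (jacobi_eigenvalue \<alpha> \<beta> i), 1:] * deriv_ratio \<alpha> \<beta> i)"

text \<open>
  At 1 the leading coefficient \<open>1 - x\<^sup>2\<close> vanishes, so the differentiated eigenvalue equation relates two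
  consecutive derivatives and nothing else. The important point is that the ratio depends polynomially
  on \<open>l\<close> and on nothing else about \<open>p\<close>.
\<close>

lemma eigenpoly_derivs_at_1:
  assumes "\<alpha> > -1" and eig: "jacobi_op \<alpha> \<beta> p = smult l p"
  shows "poly ((pderiv ^^ j) p) 1 = poly (deriv_ratio \<alpha> \<beta> j) l * poly p 1"
proof (induction j)
  case (Suc j)
  let ?e = "complex_of_real (jacobi_eigenvalue \<alpha> \<beta> j)"
  have hs: "(pderiv ^^ j) (smult l p) = smult l ((pderiv ^^ j) p)" for j
    by (induction j) (auto simp: pderiv_smult)
  define c where "c = complex_of_real (\<alpha> + 2 + real j)"
  have "l * poly ((pderiv ^^ j) p) 1 =
      - 2 * c * poly ((pderiv ^^ Suc j) p) 1 + ?e * poly ((pderiv ^^ j) p) 1"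
    using arg_cong[OF jacobi_op_higher_pderiv[of j \<alpha> \<beta> p], of "\<lambda>q. poly q 1"]
    unfolding eig hs by (simp add: lin_def c_def algebra_simps)
  moreover have "c \<noteq> 0"
    unfolding c_def of_real_eq_0_iff using assms(1) by linarith
  ultimately have "poly ((pderiv ^^ Suc j) p) 1 = - 1 / (2 * c) * ((l - ?e) * poly ((pderiv ^^ j) p) 1)"
    by (simp add: field_simps)
  also have "- 1 / (2 * c) = of_real (- 1 / (2 * (\<alpha> + 2 + real j)))"
    by (simp add: c_def)
  finally show ?case using Suc.IH by (simp add: left_diff_distrib right_diff_distrib mult.assoc)
qed simp

section \<open>Orthogonality and centres for polynomial multiples of a Jacobi weight\<close>

definition mpoly_adjoint :: "mpoly \<Rightarrow> mpoly" where
  "mpoly_adjoint Q = (\<chi> i j. map_poly cnj (Q $ j $ i))"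

lemma mpoly_adjoint_const_mult:
  "mpoly_adjoint (const_mpoly C ** Q) = mpoly_adjoint Q ** const_mpoly (adjoint_mat C)"
  unfolding vec_eq_iff
  by (intro allI poly_eqI_eval)
    (simp add: mpoly_adjoint_def const_mpoly_def adjoint_mat_def matrix_matrix_mult_def sum_2)

definition jacobi_matrix_functional :: "real \<Rightarrow> real \<Rightarrow> mpoly \<Rightarrow> cmatrix" where
  "jacobi_matrix_functional a b A = (\<chi> i j. jacobi_functional a b (A $ i $ j))"

lemma jacobi_matrix_functional_add:
  assumes "a > -1" "b > -1"
  shows "jacobi_matrix_functional a b (A + B)
    = jacobi_matrix_functional a b A + jacobi_matrix_functional a b B"
  by (simp add: jacobi_matrix_functional_def vec_eq_iff jacobi_functional_add[OF assms])

lemma jacobi_matrix_functional_const_mult: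
  assumes "a > -1" "b > -1"
  shows "jacobi_matrix_functional a b (const_mpoly C ** A) = C ** jacobi_matrix_functional a b A"
    and "jacobi_matrix_functional a b (A ** const_mpoly C) = jacobi_matrix_functional a b A ** C"
  by (simp_all add: jacobi_matrix_functional_def vec_eq_iff const_mpoly_def matrix_matrix_mult_def
      sum_2 jacobi_functional_add[OF assms] jacobi_functional_smult mult.commute)

text \<open>
  Both weights are scalar Jacobi weights with the exponents \<open>\<alpha>\<close> and \<open>\<beta>\<close> times a polynomial matrix, the
  factor \<open>1 - x\<^sup>2\<close> being counted as part of the matrix for the diagonal weight.
\<close>

definition jacobi_weight :: "real \<Rightarrow> real \<Rightarrow> mpoly \<Rightarrow> (real \<Rightarrow> cmatrix) \<Rightarrow> bool" where
  "jacobi_weight a b M U \<longleftrightarrow> a > -1 \<and> b > -1 \<and> (\<forall>x\<in>{-1<..<1}. \<forall>k l.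
     U x $ k $ l = complex_of_real ((1 - x) powr a * (1 + x) powr b) * poly (M $ k $ l) (of_real x))"

lemma weight_inner_jacobi:
  assumes "jacobi_weight a b M U"
  shows "weight_inner U P Q = jacobi_matrix_functional a b (P ** M ** mpoly_adjoint Q)"
proof -
  have "(mpoly_eval P x ** U x ** adjoint_mat (mpoly_eval Q x)) $ i $ j =
      complex_of_real ((1 - x) powr a * (1 + x) powr b) *
      poly ((P ** M ** mpoly_adjoint Q) $ i $ j) (of_real x)"
    if "x \<in> {-1<..<1}" for x i j
    using assms that unfolding jacobi_weight_def
    by (simp add: mpoly_eval_def adjoint_mat_def mpoly_adjoint_def matrix_matrix_mult_def sum_2
        algebra_simps)
  then show ?thesis
    unfolding weight_inner_def jacobi_matrix_functional_def jacobi_functional_def vec_eq_iff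
    by (auto intro!: set_lebesgue_integral_cong)
qed

lemma weight_inner_add_left:
  assumes "jacobi_weight a b M U"
  shows "weight_inner U (P + Q) R = weight_inner U P R + weight_inner U Q R"
  using assms unfolding weight_inner_jacobi[OF assms]
  by (simp add: jacobi_weight_def matrix_add_rdistrib jacobi_matrix_functional_add)

lemma weight_inner_const_left:
  assumes "jacobi_weight a b M U"
  shows "weight_inner U (const_mpoly C ** P) Q = C ** weight_inner U P Q"
  using assms unfolding weight_inner_jacobi[OF assms]
  by (simp add: jacobi_weight_def matrix_mul_assoc[symmetric] jacobi_matrix_functional_const_mult)

lemma weight_inner_const_right:
  assumes "jacobi_weight a b M U"
  shows "weight_inner U P (const_mpoly C ** Q) = weight_inner U P Q ** adjoint_mat C"
  using assms unfolding weight_inner_jacobi[OF assms]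
  by (simp add: jacobi_weight_def matrix_mul_assoc mpoly_adjoint_const_mult
      jacobi_matrix_functional_const_mult)

lemma weight_inner_diff_left:
  assumes "jacobi_weight a b M U"
  shows "weight_inner U (P - Q) R = weight_inner U P R - weight_inner U Q R"
  using weight_inner_add_left[OF assms, of "P - Q" Q R] by simp

lemma weight_inner_sum_left:
  fixes n :: nat
  assumes "jacobi_weight a b M U"
  shows "weight_inner U (\<Sum>k<n. f k) R = (\<Sum>k<n. weight_inner U (f k) R)"
proof (induction n)
  case 0
  then show ?case using weight_inner_diff_left[OF assms, of 0 0 R] by simp
qed (simp add: weight_inner_add_left[OF assms])

text \<open>
  Invertible squared norms replace positivity of the weight: expand the difference of two candidates in
  lower polynomials and pair it with each of these.
\<close>

lemma monic_orthogonal_unique: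
  assumes U: "jacobi_weight a b M U" and P: "monic_orthogonal U P" and Q: "monic_orthogonal U Q"
    and inv: "\<And>n. \<exists>B. weight_inner U (P n) (P n) ** B = mat 1"
  shows "Q = P"
proof
  fix n show "Q n = P n"
  proof (induction n rule: less_induct)
    case (less n)
    have "mpoly_coeff (Q n - P n) k = 0" if "k \<ge> n" for k
      using that P Q unfolding monic_orthogonal_def monic_of_degree_def mpoly_coeff_diff
      by (cases "k = n") auto
    then obtain C where C: "Q n - P n = (\<Sum>k<n. const_mpoly (C k) ** P k)"
      using monic_expansion[of P n "Q n - P n"] P unfolding monic_orthogonal_def by blast
    have "C k = 0" if k: "k < n" for k
    proof -
      have "weight_inner U (Q n) (P k) = 0" "weight_inner U (P n) (P k) = 0"
        using k less.IH[OF k] P Q unfolding monic_orthogonal_def by (metis less_not_refl)+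
      then have "0 = weight_inner U (Q n - P n) (P k)"
        by (simp add: weight_inner_diff_left[OF U])
      also have "\<dots> = (\<Sum>j<n. C j ** weight_inner U (P j) (P k))"
        unfolding C weight_inner_sum_left[OF U] weight_inner_const_left[OF U] ..
      also have "\<dots> = (\<Sum>j<n. if j = k then C k ** weight_inner U (P k) (P k) else 0)"
        using P by (intro sum.cong) (auto simp: monic_orthogonal_def)
      also have "\<dots> = C k ** weight_inner U (P k) (P k)"
        using k by simp
      finally have "C k ** weight_inner U (P k) (P k) = 0" by simp
      then show "C k = 0"
        using inv[of k] by (metis matrix_mul_assoc matrix_mul_rid matrix_zero_left)
    qed
    then have "Q n - P n = 0" unfolding C by simp
    then show ?case by simp
  qed
qed

text \<open>
  With uniqueness the membership condition of the algebra of a weight can be read for one explicit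
  sequence.
\<close>

definition orthogonal_basis :: "(real \<Rightarrow> cmatrix) \<Rightarrow> (nat \<Rightarrow> mpoly) \<Rightarrow> bool" where
  "orthogonal_basis U P \<longleftrightarrow> monic_orthogonal U P \<and> (\<forall>Q. monic_orthogonal U Q \<longrightarrow> Q = P)"

lemma weight_algebra_iff:
  assumes "orthogonal_basis U P"
  shows "D \<in> weight_algebra U \<longleftrightarrow> D \<in> diffops \<and> (\<forall>n. \<exists>L. D (P n) = const_mpoly L ** P n)"
  using assms unfolding weight_algebra_def orthogonal_basis_def by blast

text \<open>
  If the eigenvalues of two elements of the algebra are nonzero multiples of the two off-diagonal matrix
  units, then whatever commutes with both has scalar eigenvalues; scalars commute with everything.
\<close>

lemma weight_center_iff:
  assumes basis: "orthogonal_basis U P"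
    and T: "T \<in> diffops" "\<And>n. T (P n) = const_mpoly (mat2 0 (t n) 0 0) ** P n" "\<And>n. t n \<noteq> 0"
    and S: "S \<in> diffops" "\<And>n. S (P n) = const_mpoly (mat2 0 0 (s n) 0) ** P n" "\<And>n. s n \<noteq> 0"
  shows "D \<in> weight_center U \<longleftrightarrow>
    D \<in> diffops \<and> (\<exists>d. \<forall>n. D (P n) = const_mpoly (mat (d n)) ** P n)"
proof
  have monic: "monic_of_degree n (P n)" for n
    using basis by (simp add: orthogonal_basis_def monic_orthogonal_def)
  {
    assume "D \<in> weight_center U"
    then have D: "D \<in> weight_algebra U" "\<And>E. E \<in> weight_algebra U \<Longrightarrow> D \<odot>\<^sub>o E = E \<odot>\<^sub>o D"
      by (auto simp: weight_center_def op_center_def)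
    then obtain L where Dd: "D \<in> diffops" and L: "\<And>n. D (P n) = const_mpoly (L n) ** P n"
      unfolding weight_algebra_iff[OF basis] by metis
    have comm: "L n ** A = A ** L n"
      if E: "E \<in> weight_algebra U" "E (P n) = const_mpoly A ** P n" for E A n
    proof -
      have "E \<in> diffops" using E weight_algebra_iff[OF basis] by blast
      moreover have "E (D (P n)) = D (E (P n))"
        using fun_cong[OF D(2)[OF E(1)], of "P n"] by (simp add: op_mult_def)
      ultimately have "const_mpoly (L n ** A) ** P n = const_mpoly (A ** L n) ** P n"
        by (simp add: L E left_linear_const[OF left_linear_diffops] Dd const_mpoly_mult
            matrix_mul_assoc)
      then show ?thesis by (rule monic_const_mult_cancel[OF monic])
    qed
    have L_scalar: "mat (L n $ 1 $ 1) = L n" for n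
    proof -
      have "L n ** mat2 0 (t n) 0 0 = mat2 0 (t n) 0 0 ** L n"
        using T weight_algebra_iff[OF basis] by (intro comm[of T]) blast+
      moreover have "L n ** mat2 0 0 (s n) 0 = mat2 0 0 (s n) 0 ** L n"
        using S weight_algebra_iff[OF basis] by (intro comm[of S]) blast+
      ultimately show ?thesis
        using T(3)[of n] S(3)[of n]
        by (simp add: vec_eq_iff forall_2 matrix_matrix_mult_def sum_2 mat_def)
    qed
    then show "D \<in> diffops \<and> (\<exists>d. \<forall>n. D (P n) = const_mpoly (mat (d n)) ** P n)"
      using Dd by (intro conjI exI[of _ "\<lambda>n. L n $ 1 $ 1"]) (simp_all add: L L_scalar)
  next
    assume "D \<in> diffops \<and> (\<exists>d. \<forall>n. D (P n) = const_mpoly (mat (d n)) ** P n)"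
    then obtain d where Dd: "D \<in> diffops" and d: "\<And>n. D (P n) = const_mpoly (mat (d n)) ** P n"
      by blast
    have "D \<odot>\<^sub>o E = E \<odot>\<^sub>o D" if E_in: "E \<in> weight_algebra U" for E
    proof -
      obtain L where E: "E \<in> diffops" "\<And>n. E (P n) = const_mpoly (L n) ** P n"
        using E_in unfolding weight_algebra_iff[OF basis] by metis
      show ?thesis
      proof (rule left_linear_ext[OF _ _ monic])
        show "left_linear (D \<odot>\<^sub>o E)" "left_linear (E \<odot>\<^sub>o D)"
          using Dd E(1) by (simp_all add: left_linear_op_mult left_linear_diffops)
        fix n
        have "mat (d n) ** L n = L n ** mat (d n)" by (rule mat_commutes)
        then show "(D \<odot>\<^sub>o E) (P n) = (E \<odot>\<^sub>o D) (P n)"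
          by (simp add: op_mult_def d E left_linear_const[OF left_linear_diffops] Dd
              matrix_mul_assoc const_mpoly_mult[symmetric])
      qed
    qed
    moreover have "D \<in> weight_algebra U"
      using Dd d unfolding weight_algebra_iff[OF basis] by blast
    ultimately show "D \<in> weight_center U"
      by (auto simp: weight_center_def op_center_def)
  }
qed

section \<open>The Darboux pair\<close>

lemma map_poly_cnj_pderiv: "map_poly cnj (pderiv p) = pderiv (map_poly cnj p)"
  by (rule poly_eqI) (simp add: coeff_map_poly coeff_pderiv)

lemma op_V_entries:
  "op_V \<alpha> \<beta> v P $ i $ 1 = lin ((\<beta> - \<alpha>) / v) 1 * pderiv (P $ i $ 1)
     + lin (1 + (\<alpha> - \<beta>) / v) 0 * pderiv (P $ i $ 2) + lin ((v + 2 + \<alpha> + \<beta>) / 2) 0 * P $ i $ 1"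
  "op_V \<alpha> \<beta> v P $ i $ 2 = lin (1 + (\<beta> - \<alpha>) / v) 0 * pderiv (P $ i $ 1)
     + lin ((\<alpha> - \<beta>) / v) 1 * pderiv (P $ i $ 2) + lin ((- v + 2 + \<alpha> + \<beta>) / 2) 0 * P $ i $ 2"
  by (simp_all add: op_V_def matrix_matrix_mult_def sum_2 mpoly_deriv_def mult.commute
      del: mult_pCons_left mult_pCons_right)

lemma op_N_entries:
  "op_N \<alpha> \<beta> v P $ i $ 1 = lin ((\<beta> - \<alpha>) / v) (- 1) * pderiv (P $ i $ 1)
     + lin (1 + (\<alpha> - \<beta>) / v) 0 * pderiv (P $ i $ 2) + lin (- (1/2) * (- v + 4 + \<alpha> + \<beta>)) 0 * P $ i $ 1"
  "op_N \<alpha> \<beta> v P $ i $ 2 = lin (1 + (\<beta> - \<alpha>) / v) 0 * pderiv (P $ i $ 1)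
     + lin ((\<alpha> - \<beta>) / v) (- 1) * pderiv (P $ i $ 2) + lin (- (1/2) * (\<alpha> + \<beta> + v + 4)) 0 * P $ i $ 2"
  by (simp_all add: op_N_def matrix_matrix_mult_def sum_2 mpoly_deriv_def mult.commute
      del: mult_pCons_left mult_pCons_right)

lemma op_delta_entry: "op_delta \<alpha> \<beta> P $ i $ j = jacobi_op \<alpha> \<beta> (P $ i $ j)"
  by (simp add: op_delta_def jacobi_op_def mult_mat_entry mpoly_deriv_def mult.commute
      del: mult_pCons_left mult_pCons_right)

lemma coeff_lin_mult: "coeff (lin a b * q) k
  = of_real a * coeff q k + of_real b * (if k = 0 then 0 else coeff q (k - 1))"
  by (cases k) (simp_all add: lin_def)

text \<open>
  The Green formula for a first-order operator with matrix coefficients, written in coordinates. The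
  letters stand for values at a point: \<open>c\<^sub>i e\<^sub>i\<^sub>j\<close> are the entries of the concomitant matrix, \<open>- n\<^sub>i\<close> the
  terms of order zero of the adjoint, \<open>d\<close> and \<open>j\<close> the coefficients of integration by parts.
\<close>

lemma green_bilinear:
  fixes p1 p2 q1 q2 p1' p2' q1' q2' c1 c2 e11 e12 e21 e22 n1 n2 d j :: "'a::comm_ring_1"
  shows "p1' * q1 * (d * (c1 * e11)) + p1' * q2 * (d * (c1 * e12))
      + p2' * q1 * (d * (c2 * e21)) + p2' * q2 * (d * (c2 * e22))
      + p1 * q1 * (d * (c1 * (n1 - 1)) + j * (c1 * e11)) + p1 * q2 * (j * (c1 * e12))
      + p2 * q1 * (j * (c2 * e21)) + p2 * q2 * (d * (c2 * (n2 - 1)) + j * (c2 * e22))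
    = d * (- c1 * (p1 * (e11 * q1' + e12 * q2' - n1 * q1)) + - c2 * (p2 * (e21 * q1' + e22 * q2' - n2 * q2)))
      + (d * (p1' * (c1 * (e11 * q1 + e12 * q2)) + p1 * (c1 * (e11 * q1' - q1 + e12 * q2'))
          + p2' * (c2 * (e21 * q1 + e22 * q2)) + p2 * (c2 * (e21 * q1' + e22 * q2' - q2)))
        + j * (p1 * (c1 * (e11 * q1 + e12 * q2)) + p2 * (c2 * (e21 * q1 + e22 * q2))))"
  by (simp add: algebra_simps)

locale jacobi_parameters =
  fixes \<alpha> \<beta> v :: real
  assumes v_lower: "\<bar>\<alpha> - \<beta>\<bar> < \<bar>v\<bar>" and v_upper: "\<bar>v\<bar> < \<alpha> + \<beta> + 2"
begin

abbreviation "\<V> \<equiv> op_V \<alpha> \<beta> v"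
abbreviation "\<N> \<equiv> op_N \<alpha> \<beta> v"
abbreviation "\<A> \<equiv> op_A \<alpha> \<beta> v"
abbreviation "\<delta> \<equiv> op_delta \<alpha> \<beta>"

text \<open>
  Both exponents exceed \<open>-1\<close> since \<open>2 min \<alpha> \<beta> = \<alpha> + \<beta> - |\<alpha> - \<beta>| > -2\<close>.
\<close>

lemma alpha_gt: "\<alpha> > -1" and beta_gt: "\<beta> > -1" and v_nonzero: "v \<noteq> 0"
  and v_plus: "v + \<alpha> - \<beta> \<noteq> 0" and v_minus: "v - \<alpha> + \<beta> \<noteq> 0"
  using v_lower v_upper by linarith+

definition root1 :: real where "root1 = (1/4) * (- v + 4 + \<alpha> + \<beta>) * (v + 2 + \<alpha> + \<beta>)"

definition root2 :: real where "root2 = (1/4) * (\<alpha> + \<beta> + v + 4) * (- v + 2 + \<alpha> + \<beta>)"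

lemma root_diff: "root1 - root2 = v"
  by (simp add: root1_def root2_def field_simps)

text \<open>
  The Darboux factorisation. The leading coefficients multiply to the scalar \<open>1 - x\<^sup>2\<close>, which removes the
  mixed second-order terms; the terms of order zero make the mixed first-order terms cancel and turn
  the diagonal ones into those of \<open>\<delta>\<close>, by \<open>v \<cdot> (\<beta> - \<alpha>) / v = \<beta> - \<alpha>\<close>.
\<close>

lemma op_V_N_entries:
  "\<N> (\<V> P) $ i $ 1 = jacobi_op \<alpha> \<beta> (P $ i $ 1) - smult (of_real root1) (P $ i $ 1)"
  "\<N> (\<V> P) $ i $ 2 = jacobi_op \<alpha> \<beta> (P $ i $ 2) - smult (of_real root2) (P $ i $ 2)"
proof -
  define b where "b = (\<beta> - \<alpha>) / v"
  have b: "(\<alpha> - \<beta>) / v = - b" "\<beta> = \<alpha> + b * v"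
    using v_nonzero by (simp_all add: b_def field_simps)
  show "\<N> (\<V> P) $ i $ 1 = jacobi_op \<alpha> \<beta> (P $ i $ 1) - smult (of_real root1) (P $ i $ 1)"
    and "\<N> (\<V> P) $ i $ 2 = jacobi_op \<alpha> \<beta> (P $ i $ 2) - smult (of_real root2) (P $ i $ 2)"
    unfolding op_N_entries op_V_entries b_def[symmetric] b(1) jacobi_op_def root1_def root2_def
    unfolding b(2)
    by (rule poly_eqI_eval,
      simp add: lin_def pderiv_add pderiv_mult pderiv_pCons pderiv_diff pderiv_smult field_simps)+
qed

text \<open>
  Compared with the product of \<open>\<V>\<close> and \<open>\<N>\<close> the two roots are exchanged, so that together both factors
  occur in each row.
\<close>

lemma op_A_entries:
  "\<A> P $ i $ 1 = jacobi_op \<alpha> \<beta> (P $ i $ 1) - smult (of_real root2) (P $ i $ 1)"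
  "\<A> P $ i $ 2 = jacobi_op \<alpha> \<beta> (P $ i $ 2) - smult (of_real root1) (P $ i $ 2)"
proof -
  have "lin (- (1/4) * (\<alpha> + \<beta> + v + 4) * (- v + 2 + \<alpha> + \<beta>)) 0 = [:- of_real root2:]"
    and "lin (- (1/4) * (- v + 4 + \<alpha> + \<beta>) * (v + 2 + \<alpha> + \<beta>)) 0 = [:- of_real root1:]"
    by (simp_all add: lin_def root1_def root2_def)
  then show "\<A> P $ i $ 1 = jacobi_op \<alpha> \<beta> (P $ i $ 1) - smult (of_real root2) (P $ i $ 1)"
    and "\<A> P $ i $ 2 = jacobi_op \<alpha> \<beta> (P $ i $ 2) - smult (of_real root1) (P $ i $ 2)"
    by (simp_all add: op_A_def op_add_def op_delta_entry matrix_matrix_mult_def sum_2)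
qed

definition weight_poly :: mpoly where
  "weight_poly = (let u = [:1/2, -1/2:] in mat2
     (smult (of_real (v * (v + 2 + \<alpha> + \<beta>) / (v + \<alpha> - \<beta>))) (u^2)
        + smult (of_real (- (v + \<alpha> + \<beta> + 2))) u + [:of_real (\<alpha> + 1):])
     (smult (of_real (\<alpha> + \<beta> + 2)) u + [:of_real (- \<alpha> - 1):])
     (smult (of_real (\<alpha> + \<beta> + 2)) u + [:of_real (- \<alpha> - 1):])
     (smult (of_real (v * (- v + 2 + \<alpha> + \<beta>) / (v - \<alpha> + \<beta>))) (u^2)
        + smult (of_real (- (- v + \<alpha> + \<beta> + 2))) u + [:of_real (\<alpha> + 1):]))"

lemma jacobi_weight_W: "jacobi_weight \<alpha> \<beta> weight_poly (W \<alpha> \<beta> v)"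
proof -
  define K1 K2 where "K1 = v * (v + 2 + \<alpha> + \<beta>) / (v + \<alpha> - \<beta>)"
    and "K2 = v * (- v + 2 + \<alpha> + \<beta>) / (v - \<alpha> + \<beta>)"
  have "poly (weight_poly $ k $ l) (complex_of_real x) = complex_of_real ((((1 - x)^2 / 4) *\<^sub>R W2 \<alpha> \<beta> v
      + ((1 - x) / 2) *\<^sub>R W1 \<alpha> \<beta> v + W0 \<alpha>) $ k $ l)" for x k l
  proof -
    have "\<forall>k l. poly (weight_poly $ k $ l) (complex_of_real x) = complex_of_real ((((1 - x)^2 / 4) *\<^sub>R W2 \<alpha> \<beta> v
      + ((1 - x) / 2) *\<^sub>R W1 \<alpha> \<beta> v + W0 \<alpha>) $ k $ l)"
      unfolding weight_poly_def W2_def K1_def[symmetric] K2_def[symmetric] forall_2 Let_def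
      by (simp add: W1_def W0_def, simp add: power2_eq_square field_simps)
    then show ?thesis by blast
  qed
  then show ?thesis
    unfolding jacobi_weight_def by (simp add: alpha_gt beta_gt W_def complex_mat_def)
qed

lemma jacobi_weight_W_tilde: "jacobi_weight \<alpha> \<beta> (mat [:1, 0, -1:]) (W_tilde \<alpha> \<beta>)"
  unfolding jacobi_weight_def forall_2
  by (simp add: alpha_gt beta_gt W_tilde_def complex_mat_def mat_def powr_add algebra_simps)

lemma mpoly_adjoint_op_N:
  "mpoly_adjoint (\<N> Q) $ 1 $ j = lin ((\<beta> - \<alpha>) / v) (- 1) * pderiv (map_poly cnj (Q $ j $ 1))
     + lin (1 + (\<alpha> - \<beta>) / v) 0 * pderiv (map_poly cnj (Q $ j $ 2))
     + lin (- (1/2) * (- v + 4 + \<alpha> + \<beta>)) 0 * map_poly cnj (Q $ j $ 1)"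
  "mpoly_adjoint (\<N> Q) $ 2 $ j = lin (1 + (\<beta> - \<alpha>) / v) 0 * pderiv (map_poly cnj (Q $ j $ 1))
     + lin ((\<alpha> - \<beta>) / v) (- 1) * pderiv (map_poly cnj (Q $ j $ 2))
     + lin (- (1/2) * (\<alpha> + \<beta> + v + 4)) 0 * map_poly cnj (Q $ j $ 2)"
  by (rule poly_eqI_eval,
    simp add: mpoly_adjoint_def op_N_entries map_poly_cnj_pderiv[symmetric] lin_def)+

text \<open>
  This is \<open>- W\<^sub>2 / 4\<close>. The adjoint of \<open>\<V>\<close> between the two weights is \<open>\<N>\<close> followed by multiplication
  with this matrix.
\<close>

definition adjoint_factor :: cmatrix where
  "adjoint_factor = mat2 (of_real (- v * (v + 2 + \<alpha> + \<beta>) / (4 * (v + \<alpha> - \<beta>)))) 0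
     0 (of_real (- v * (- v + 2 + \<alpha> + \<beta>) / (4 * (v - \<alpha> + \<beta>))))"

text \<open>
  The integrand of \<open>\<langle>p \<V>, q\<rangle>\<close> for \<open>W\<close> and that of \<open>\<langle>p, q \<N> C\<rangle>\<close> for the diagonal weight differ by an
  expression on which the Jacobi functional vanishes. The polynomials \<open>V1\<close>, \<open>V2\<close> and \<open>N1\<close>, \<open>N2\<close> are the
  images of the rows \<open>p\<close> and \<open>q\<close> under \<open>\<V>\<close> and \<open>\<N>\<close>.
\<close>

lemma parts_polynomial_identity:
  fixes p1 p2 q1 q2 :: "complex poly"
  defines "V1 \<equiv> lin ((\<beta> - \<alpha>) / v) 1 * pderiv p1
     + lin (1 + (\<alpha> - \<beta>) / v) 0 * pderiv p2 + lin ((v + 2 + \<alpha> + \<beta>) / 2) 0 * p1"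
    and "V2 \<equiv> lin (1 + (\<beta> - \<alpha>) / v) 0 * pderiv p1
     + lin ((\<alpha> - \<beta>) / v) 1 * pderiv p2 + lin ((- v + 2 + \<alpha> + \<beta>) / 2) 0 * p2"
    and "N1 \<equiv> lin ((\<beta> - \<alpha>) / v) (- 1) * pderiv q1
     + lin (1 + (\<alpha> - \<beta>) / v) 0 * pderiv q2 + lin (- (1/2) * (- v + 4 + \<alpha> + \<beta>)) 0 * q1"
    and "N2 \<equiv> lin (1 + (\<beta> - \<alpha>) / v) 0 * pderiv q1
     + lin ((\<alpha> - \<beta>) / v) (- 1) * pderiv q2 + lin (- (1/2) * (\<alpha> + \<beta> + v + 4)) 0 * q2"
    and "k1 \<equiv> adjoint_factor $ 1 $ 1" and "k2 \<equiv> adjoint_factor $ 2 $ 2"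
  shows "\<exists>f. V1 * weight_poly $ 1 $ 1 * q1 + V1 * weight_poly $ 1 $ 2 * q2
      + V2 * weight_poly $ 2 $ 1 * q1 + V2 * weight_poly $ 2 $ 2 * q2
    = [:1, 0, -1:] * (smult k1 (p1 * N1) + smult k2 (p2 * N2))
      + ([:1, 0, -1:] * pderiv f + [:complex_of_real (\<beta> - \<alpha>), - complex_of_real (\<alpha> + \<beta> + 2):] * f)"
proof -
  \<comment> \<open>In terms of \<open>b\<close>, \<open>w1\<close>, \<open>w2\<close> all parameters are polynomials, so no division is left.\<close>
  define b w1 w2 where "b = (\<beta> - \<alpha>) / v"
    and "w1 = v * (v + 2 + \<alpha> + \<beta>) / (v + \<alpha> - \<beta>)"
    and "w2 = v * (- v + 2 + \<alpha> + \<beta>) / (v - \<alpha> + \<beta>)"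
  have b: "(\<alpha> - \<beta>) / v = - b"
    by (simp add: b_def minus_divide_left)
  have bv: "b * v = \<beta> - \<alpha>"
    using v_nonzero by (simp add: b_def)
  have "1 - b = (v + \<alpha> - \<beta>) / v" "1 + b = (v - \<alpha> + \<beta>) / v"
    using v_nonzero by (simp_all add: b_def field_simps)
  then have e1: "w1 * (1 - b) = v + 2 + \<alpha> + \<beta>" and e2: "w2 * (1 + b) = - v + 2 + \<alpha> + \<beta>"
    using v_nonzero v_plus v_minus by (simp_all add: w1_def w2_def)
  have v_eq: "v = (w1 * (1 - b) - w2 * (1 + b)) / 2"
    and ab: "\<alpha> + \<beta> = (w1 * (1 - b) + w2 * (1 + b)) / 2 - 2"
    unfolding e1 e2 by (simp_all add: field_simps)
  have "b * ((w1 * (1 - b) - w2 * (1 + b)) / 2) = \<beta> - \<alpha>"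
    using bv unfolding v_eq[symmetric] .
  then have a_eq: "\<alpha> = ((w1 * (1 - b) + w2 * (1 + b)) / 2 - 2 - b * ((w1 * (1 - b) - w2 * (1 + b)) / 2)) / 2"
    and b_eq: "\<beta> = ((w1 * (1 - b) + w2 * (1 + b)) / 2 - 2 + b * ((w1 * (1 - b) - w2 * (1 + b)) / 2)) / 2"
    using ab by argo+
  have k: "k1 = of_real (- w1 / 4)" "k2 = of_real (- w2 / 4)"
    by (simp_all add: k1_def k2_def adjoint_factor_def w1_def w2_def)
  let ?w1 = "complex_of_real w1" and ?w2 = "complex_of_real w2"
  \<comment> \<open>The concomitant is \<open>f = p S q\<close>, where \<open>(1 - x\<^sup>2) S\<close> is the leading coefficient of \<open>\<V>\<close> times the
    matrix \<open>weight_poly\<close>; this product vanishes at both endpoints, so \<open>S\<close> is a polynomial matrix.\<close>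
  let ?f = "p1 * (smult (?w1 / 4) (lin b (-1) * q1 + lin (1 - b) 0 * q2))
     + p2 * (smult (?w2 / 4) (lin (1 + b) 0 * q1 + lin (- b) (-1) * q2))"
  show ?thesis
  proof (rule exI[of _ ?f], rule poly_eqI_eval)
    fix x
    let ?b = "complex_of_real b" and ?v = "complex_of_real v"
      and ?a = "complex_of_real \<alpha>" and ?c = "complex_of_real \<beta>"
    define m where "m = (\<lambda>k l. poly (weight_poly $ k $ l) x)"
    define J where "J = (?c - ?a) - (?a + ?c + 2) * x"
    have Jp: "poly [:complex_of_real (\<beta> - \<alpha>), - complex_of_real (\<alpha> + \<beta> + 2):] x = J"
      by (simp add: J_def algebra_simps)
    have v': "?v = (?w1 * (1 - ?b) - ?w2 * (1 + ?b)) / 2"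
      by (subst v_eq) simp
    have a': "?a = ((?w1 * (1 - ?b) + ?w2 * (1 + ?b)) / 2 - 2
        - ?b * ((?w1 * (1 - ?b) - ?w2 * (1 + ?b)) / 2)) / 2"
      by (subst a_eq) simp
    have c': "?c = ((?w1 * (1 - ?b) + ?w2 * (1 + ?b)) / 2 - 2
        + ?b * ((?w1 * (1 - ?b) - ?w2 * (1 + ?b)) / 2)) / 2"
      by (subst b_eq) simp
    have m11: "m 1 1 = ?w1 * ((1 - x) / 2)^2 - (?v + ?a + ?c + 2) * ((1 - x) / 2) + (?a + 1)"
      and m12: "m 1 2 = (?a + ?c + 2) * ((1 - x) / 2) - (?a + 1)"
      and m21: "m 2 1 = m 1 2"
      and m22: "m 2 2 = ?w2 * ((1 - x) / 2)^2 - (- ?v + ?a + ?c + 2) * ((1 - x) / 2) + (?a + 1)"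
      unfolding m_def weight_poly_def w1_def[symmetric] w2_def[symmetric] Let_def mat2_entries
      by (simp_all add: diff_divide_distrib algebra_simps)
    note to_params = m11 m12 m22 J_def v' a' c'
    have lead: "(x + ?b) * m 1 1 + (1 + ?b) * m 1 2 = (1 - x^2) * (?w1 / 4 * (?b - x))"
      "(x + ?b) * m 1 2 + (1 + ?b) * m 2 2 = (1 - x^2) * (?w1 / 4 * (1 - ?b))"
      "(1 - ?b) * m 1 1 + (x - ?b) * m 1 2 = (1 - x^2) * (?w2 / 4 * (1 + ?b))"
      "(1 - ?b) * m 1 2 + (x - ?b) * m 2 2 = (1 - x^2) * (?w2 / 4 * (- ?b - x))"
      unfolding to_params by (simp_all add: power2_eq_square field_simps)
    have zero: "(?v + 2 + ?a + ?c) / 2 * m 1 1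
          = (1 - x^2) * (?w1 / 4 * ((- ?v + 4 + ?a + ?c) / 2 - 1)) + J * (?w1 / 4 * (?b - x))"
      "(?v + 2 + ?a + ?c) / 2 * m 1 2 = J * (?w1 / 4 * (1 - ?b))"
      "(- ?v + 2 + ?a + ?c) / 2 * m 1 2 = J * (?w2 / 4 * (1 + ?b))"
      "(- ?v + 2 + ?a + ?c) / 2 * m 2 2
          = (1 - x^2) * (?w2 / 4 * ((?v + 4 + ?a + ?c) / 2 - 1)) + J * (?w2 / 4 * (- ?b - x))"
      unfolding to_params by (simp_all add: power2_eq_square field_simps)
    define P1 P2 Q1 Q2 P1' P2' Q1' Q2' where "P1 = poly p1 x" and "P2 = poly p2 x"
      and "Q1 = poly q1 x" and "Q2 = poly q2 x" and "P1' = poly (pderiv p1) x"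
      and "P2' = poly (pderiv p2) x" and "Q1' = poly (pderiv q1) x" and "Q2' = poly (pderiv q2) x"
    note atoms = P1_def P2_def Q1_def Q2_def P1'_def P2'_def Q1'_def Q2'_def
    let ?a1 = "(?v + 2 + ?a + ?c) / 2" and ?a2 = "(- ?v + 2 + ?a + ?c) / 2"
    have V1: "poly V1 x = (x + ?b) * P1' + (1 - ?b) * P2' + ?a1 * P1"
      and V2: "poly V2 x = (1 + ?b) * P1' + (x - ?b) * P2' + ?a2 * P2"
      and N1: "poly N1 x = (?b - x) * Q1' + (1 - ?b) * Q2' - (- ?v + 4 + ?a + ?c) / 2 * Q1"
      and N2: "poly N2 x = (1 + ?b) * Q1' + (- ?b - x) * Q2' - (?v + 4 + ?a + ?c) / 2 * Q2"
      unfolding V1_def V2_def N1_def N2_def b_def[symmetric] b poly_add poly_mult atoms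
      by (simp_all add: lin_def add_divide_distrib diff_divide_distrib algebra_simps)
    let ?S1 = "?w1 / 4 * ((?b - x) * Q1 + (1 - ?b) * Q2)"
    let ?S2 = "?w2 / 4 * ((1 + ?b) * Q1 + (- ?b - x) * Q2)"
    have f: "poly ?f x = P1 * ?S1 + P2 * ?S2"
      unfolding atoms poly_add poly_mult poly_smult lin_def by simp
    have f': "poly (pderiv ?f) x = P1' * ?S1 + P1 * (?w1 / 4 * ((?b - x) * Q1' - Q1 + (1 - ?b) * Q2'))
        + P2' * ?S2 + P2 * (?w2 / 4 * ((1 + ?b) * Q1' + (- ?b - x) * Q2' - Q2))"
      unfolding atoms pderiv_add pderiv_mult pderiv_smult poly_add poly_mult poly_smult lin_def
      by (simp add: pderiv_pCons algebra_simps)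
    have "poly (V1 * weight_poly $ 1 $ 1 * q1 + V1 * weight_poly $ 1 $ 2 * q2
        + V2 * weight_poly $ 2 $ 1 * q1 + V2 * weight_poly $ 2 $ 2 * q2) x
      = ((x + ?b) * P1' + (1 - ?b) * P2' + ?a1 * P1) * (m 1 1 * Q1 + m 1 2 * Q2)
        + ((1 + ?b) * P1' + (x - ?b) * P2' + ?a2 * P2) * (m 1 2 * Q1 + m 2 2 * Q2)"
      unfolding V1[symmetric] V2[symmetric] poly_add poly_mult
      by (simp only: m21[unfolded m_def] m_def Q1_def Q2_def distrib_left mult.assoc add.assoc)
    also have "\<dots> = P1' * Q1 * ((x + ?b) * m 1 1 + (1 + ?b) * m 1 2)
        + P1' * Q2 * ((x + ?b) * m 1 2 + (1 + ?b) * m 2 2)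
        + P2' * Q1 * ((1 - ?b) * m 1 1 + (x - ?b) * m 1 2)
        + P2' * Q2 * ((1 - ?b) * m 1 2 + (x - ?b) * m 2 2)
        + P1 * Q1 * (?a1 * m 1 1) + P1 * Q2 * (?a1 * m 1 2)
        + P2 * Q1 * (?a2 * m 1 2) + P2 * Q2 * (?a2 * m 2 2)"
      by (simp only: ring_distribs ac_simps)
    also have "\<dots> = (1 - x^2) * (- (?w1 / 4) * (P1 * poly N1 x) + - (?w2 / 4) * (P2 * poly N2 x))
        + ((1 - x^2) * poly (pderiv ?f) x + J * poly ?f x)"
      unfolding lead zero f f' N1 N2 by (rule green_bilinear)
    also have "\<dots> = poly ([:1, 0, -1:] * (smult k1 (p1 * N1) + smult k2 (p2 * N2)) + ([:1, 0, -1:] * pderiv ?f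
        + [:complex_of_real (\<beta> - \<alpha>), - complex_of_real (\<alpha> + \<beta> + 2):] * ?f)) x"
      unfolding k poly_add poly_mult poly_smult P1_def P2_def Jp
      by (simp add: power2_eq_square)
    finally show "poly (V1 * weight_poly $ 1 $ 1 * q1 + V1 * weight_poly $ 1 $ 2 * q2
        + V2 * weight_poly $ 2 $ 1 * q1 + V2 * weight_poly $ 2 $ 2 * q2) x
      = poly ([:1, 0, -1:] * (smult k1 (p1 * N1) + smult k2 (p2 * N2)) + ([:1, 0, -1:] * pderiv ?f
        + [:complex_of_real (\<beta> - \<alpha>), - complex_of_real (\<alpha> + \<beta> + 2):] * ?f)) x" .
  qed
qed

lemma op_V_adjoint:
  "weight_inner (W \<alpha> \<beta> v) (\<V> P) Q
    = weight_inner (W_tilde \<alpha> \<beta>) P (\<N> Q ** const_mpoly adjoint_factor)"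
proof -
  let ?L = "jacobi_functional \<alpha> \<beta>"
  have parts: "?L (g + ([:1, 0, -1:] * pderiv f
      + [:complex_of_real (\<beta> - \<alpha>), - complex_of_real (\<alpha> + \<beta> + 2):] * f)) = ?L g" for f g
    using jacobi_functional_add[OF alpha_gt beta_gt] jacobi_functional_parts[OF alpha_gt beta_gt]
    by simp
  have factor: "adjoint_factor $ 1 $ 2 = 0" "adjoint_factor $ 2 $ 1 = 0"
    "cnj (adjoint_factor $ 1 $ 1) = adjoint_factor $ 1 $ 1"
    "cnj (adjoint_factor $ 2 $ 2) = adjoint_factor $ 2 $ 2"
    by (simp_all add: adjoint_factor_def)
  have factor_adjoint: "adjoint_mat adjoint_factor = adjoint_factor"
    by (simp add: vec_eq_iff forall_2 adjoint_mat_def factor)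
  have adj: "mpoly_adjoint (R ** const_mpoly adjoint_factor) $ k $ j
      = smult (adjoint_factor $ k $ k) (mpoly_adjoint R $ k $ j)" for R k j
  proof -
    have "\<forall>k. mpoly_adjoint (R ** const_mpoly adjoint_factor) $ k $ j
        = smult (adjoint_factor $ k $ k) (mpoly_adjoint R $ k $ j)"
      unfolding forall_2
      by (intro conjI poly_eqI_eval)
        (simp_all add: mpoly_adjoint_def const_mpoly_def matrix_matrix_mult_def sum_2 factor)
    then show ?thesis by blast
  qed
  have "?L ((\<V> P ** weight_poly ** mpoly_adjoint Q) $ i $ j)
      = ?L ((P ** mat [:1, 0, -1:] ** mpoly_adjoint (\<N> Q ** const_mpoly adjoint_factor)) $ i $ j)" for i j
  proof -
    obtain f where f: "(\<V> P ** weight_poly ** mpoly_adjoint Q) $ i $ j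
      = [:1, 0, -1:] * (smult (adjoint_factor $ 1 $ 1) (P $ i $ 1 * mpoly_adjoint (\<N> Q) $ 1 $ j)
          + smult (adjoint_factor $ 2 $ 2) (P $ i $ 2 * mpoly_adjoint (\<N> Q) $ 2 $ j))
        + ([:1, 0, -1:] * pderiv f + [:complex_of_real (\<beta> - \<alpha>), - complex_of_real (\<alpha> + \<beta> + 2):] * f)"
      using parts_polynomial_identity[of "P $ i $ 1" "P $ i $ 2" "map_poly cnj (Q $ j $ 1)" "map_poly cnj (Q $ j $ 2)",
        folded op_V_entries mpoly_adjoint_op_N]
      by (auto simp: matrix_matrix_mult_def sum_2 mpoly_adjoint_def algebra_simps)
    have "(P ** mat [:1, 0, -1:] ** mpoly_adjoint (\<N> Q ** const_mpoly adjoint_factor)) $ i $ j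
      = [:1, 0, -1:] * (smult (adjoint_factor $ 1 $ 1) (P $ i $ 1 * mpoly_adjoint (\<N> Q) $ 1 $ j)
          + smult (adjoint_factor $ 2 $ 2) (P $ i $ 2 * mpoly_adjoint (\<N> Q) $ 2 $ j))"
      unfolding matrix_matrix_mult_def[of "P ** mat [:1, 0, -1:]"] sum_2 vec_lambda_beta mult_mat_entry adj
      by (rule poly_eqI_eval) (simp add: algebra_simps)
    then show ?thesis unfolding f parts by simp
  qed
  then show ?thesis
    unfolding weight_inner_jacobi[OF jacobi_weight_W] weight_inner_jacobi[OF jacobi_weight_W_tilde]
    by (simp add: vec_eq_iff jacobi_matrix_functional_def)
qed

section \<open>The orthogonal polynomials of both weights\<close>

definition lam :: "nat \<Rightarrow> complex" where
  "lam n = complex_of_real (jacobi_eigenvalue \<alpha> \<beta> n)"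

lemma lam_inj: "lam m = lam n \<longleftrightarrow> m = n"
  by (simp add: lam_def jacobi_eigenvalue_inj[OF alpha_gt beta_gt])

lemma inj_lam: "inj lam"
  by (simp add: inj_def lam_inj)

definition jacobi_poly :: "nat \<Rightarrow> complex poly" where
  "jacobi_poly n = (SOME p. degree p = n \<and> coeff p n = 1 \<and> map_poly cnj p = p \<and>
    jacobi_op \<alpha> \<beta> p = smult (lam n) p)"

lemma jacobi_poly_props: "degree (jacobi_poly n) = n" "coeff (jacobi_poly n) n = 1" "map_poly cnj (jacobi_poly n) = jacobi_poly n"
  "jacobi_op \<alpha> \<beta> (jacobi_poly n) = smult (lam n) (jacobi_poly n)"
  using someI_ex[OF jacobi_eigenpoly_exists[OF alpha_gt beta_gt, of n], folded lam_def]
  unfolding jacobi_poly_def by blast+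

lemma jacobi_poly_nonzero: "jacobi_poly n \<noteq> 0"
  using jacobi_poly_props(2)[of n] by auto

text \<open>
  Otherwise all derivatives at 1 would vanish, including the highest one, which is a factorial.
\<close>

lemma jacobi_poly_at_1: "poly (jacobi_poly n) 1 \<noteq> 0"
proof
  assume "poly (jacobi_poly n) 1 = 0"
  then have "poly ((pderiv ^^ n) (jacobi_poly n)) 1 = 0"
    using eigenpoly_derivs_at_1[OF alpha_gt jacobi_poly_props(4)] by simp
  moreover have "(pderiv ^^ n) (jacobi_poly n) = [:fact n:]"
    by (rule poly_eqI)
      (simp add: coeff_higher_pderiv jacobi_poly_props coeff_pCons coeff_eq_0 pochhammer_fact split: nat.split)
  ultimately show False by simp
qed

text \<open>
  The operator is symmetric: the difference of the two sides of the symmetry relation is an exact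
  expression for \<open>f = (1 - x\<^sup>2)(p' q - p q')\<close>. Distinct eigenvalues then force orthogonality.
\<close>

lemma jacobi_poly_orthogonal:
  assumes "m \<noteq> n"
  shows "jacobi_functional \<alpha> \<beta> ([:1, 0, -1:] * (jacobi_poly m * jacobi_poly n)) = 0"
proof -
  let ?L = "jacobi_functional \<alpha> \<beta>" and ?p = "jacobi_poly m" and ?q = "jacobi_poly n"
  let ?f = "[:1, 0, -1:] * (pderiv ?p * ?q - ?p * pderiv ?q)"
  have "[:1, 0, -1:] * pderiv ?f
      + [:complex_of_real (\<beta> - \<alpha>), - complex_of_real (\<alpha> + \<beta> + 2):] * ?f
      = [:1, 0, -1:] * (jacobi_op \<alpha> \<beta> ?p * ?q - ?p * jacobi_op \<alpha> \<beta> ?q)"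
    unfolding jacobi_op_def lin_def pderiv_mult pderiv_diff
    by (rule poly_eqI_eval, unfold poly_add poly_mult poly_diff) (simp add: pderiv_pCons algebra_simps)
  also have "\<dots> = smult (lam m - lam n) ([:1, 0, -1:] * (?p * ?q))"
    unfolding jacobi_poly_props by (simp add: smult_diff_left smult_diff_right algebra_simps del: mult_pCons_left)
  finally have "(lam m - lam n) * ?L ([:1, 0, -1:] * (?p * ?q)) = 0"
    using jacobi_functional_parts[OF alpha_gt beta_gt, of ?f] by (simp only: jacobi_functional_smult)
  then show ?thesis using assms lam_inj by simp
qed

text \<open>
  Absorbing \<open>1 - x\<^sup>2\<close> into the weight raises both exponents by one.
\<close>

lemma jacobi_poly_norm: "jacobi_functional \<alpha> \<beta> ([:1, 0, -1:] * (jacobi_poly n * jacobi_poly n)) \<noteq> 0"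
proof -
  have "jacobi_functional \<alpha> \<beta> ([:1, 0, -1:] * q) = jacobi_functional (\<alpha> + 1) (\<beta> + 1) q" for q
    unfolding jacobi_functional_def
    by (intro set_lebesgue_integral_cong) (auto simp: powr_add algebra_simps)
  then show ?thesis
    using jacobi_functional_square_nonzero[of "\<alpha> + 1" "\<beta> + 1" "jacobi_poly n"] alpha_gt beta_gt jacobi_poly_nonzero jacobi_poly_props(3)
    by simp
qed

definition P_tilde :: "nat \<Rightarrow> mpoly" where
  "P_tilde n = mat (jacobi_poly n)"

lemma mpoly_adjoint_P_tilde: "mpoly_adjoint (P_tilde n) = P_tilde n"
  by (simp add: mpoly_adjoint_def P_tilde_def vec_eq_iff mat_def jacobi_poly_props(3))

lemma P_tilde_monic: "monic_of_degree n (P_tilde n)"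
  using jacobi_poly_props(1,2)[of n] by (auto simp: monic_of_degree_def P_tilde_def mpoly_coeff_def mat_def vec_eq_iff coeff_eq_0)

lemma P_tilde_inner: "weight_inner (W_tilde \<alpha> \<beta>) (P_tilde m) (P_tilde n)
  = mat (jacobi_functional \<alpha> \<beta> ([:1, 0, -1:] * (jacobi_poly m * jacobi_poly n)))"
proof -
  have "P_tilde m ** mat [:1, 0, -1:] ** P_tilde n = mat ([:1, 0, -1:] * (jacobi_poly m * jacobi_poly n))"
    by (simp only: P_tilde_def mat_mult_mat ac_simps)
  moreover have "jacobi_functional \<alpha> \<beta> 0 = 0"
    by (simp add: jacobi_functional_def)
  ultimately show ?thesis
    unfolding weight_inner_jacobi[OF jacobi_weight_W_tilde] mpoly_adjoint_P_tilde
    by (simp only: jacobi_matrix_functional_def vec_eq_iff vec_lambda_beta mat_def if_distrib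
        [of "jacobi_functional \<alpha> \<beta>"]) simp
qed

lemma orthogonal_basis_W_tilde: "orthogonal_basis (W_tilde \<alpha> \<beta>) P_tilde"
proof -
  have "monic_orthogonal (W_tilde \<alpha> \<beta>) P_tilde"
    by (auto simp: monic_orthogonal_def P_tilde_monic P_tilde_inner jacobi_poly_orthogonal mat_def vec_eq_iff
        simp del: mult_pCons_left)
  then show ?thesis
    unfolding orthogonal_basis_def
    using monic_orthogonal_unique[OF jacobi_weight_W_tilde] mat_inverse[OF jacobi_poly_norm] P_tilde_inner by metis
qed

text \<open>
  The diagonal entries by which \<open>\<V>\<close> and \<open>\<N>\<close> multiply when they exchange the two orthogonal sequences.
\<close>

definition V_eig1 :: "nat \<Rightarrow> real" where "V_eig1 n = real n + (v + 2 + \<alpha> + \<beta>) / 2"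

definition V_eig2 :: "nat \<Rightarrow> real" where "V_eig2 n = real n + (- v + 2 + \<alpha> + \<beta>) / 2"

definition N_eig1 :: "nat \<Rightarrow> real" where "N_eig1 n = - (real n + (- v + 4 + \<alpha> + \<beta>) / 2)"

definition N_eig2 :: "nat \<Rightarrow> real" where "N_eig2 n = - (real n + (v + 4 + \<alpha> + \<beta>) / 2)"

lemma eig_nonzero: "V_eig1 n \<noteq> 0" "V_eig2 n \<noteq> 0" "N_eig1 n \<noteq> 0" "N_eig2 n \<noteq> 0"
proof -
  have "real n \<ge> 0" by simp
  then have "V_eig1 n > 0" "V_eig2 n > 0" "N_eig1 n < 0" "N_eig2 n < 0"
    using v_upper unfolding V_eig1_def V_eig2_def N_eig1_def N_eig2_def by argo+
  then show "V_eig1 n \<noteq> 0" "V_eig2 n \<noteq> 0" "N_eig1 n \<noteq> 0" "N_eig2 n \<noteq> 0" by simp_all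
qed

lemma eig_mult: "of_real (V_eig1 n) * of_real (N_eig1 n) = lam n - of_real root1"
  "of_real (V_eig2 n) * of_real (N_eig2 n) = lam n - of_real root2"
  unfolding of_real_mult[symmetric] lam_def of_real_diff[symmetric] of_real_eq_iff
  by (simp_all add: V_eig1_def V_eig2_def N_eig1_def N_eig2_def root1_def root2_def jacobi_eigenvalue_def field_simps)

definition V_eig :: "nat \<Rightarrow> cmatrix" where "V_eig n = diag (of_real (V_eig1 n)) (of_real (V_eig2 n))"

definition V_eig_inv :: "nat \<Rightarrow> cmatrix" where "V_eig_inv n = diag (1 / of_real (V_eig1 n)) (1 / of_real (V_eig2 n))"

definition N_eig :: "nat \<Rightarrow> cmatrix" where "N_eig n = diag (of_real (N_eig1 n)) (of_real (N_eig2 n))"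

lemma V_eig_inverse: "V_eig n ** V_eig_inv n = mat 1" "V_eig_inv n ** V_eig n = mat 1"
  using eig_nonzero[of n] by (simp_all add: V_eig_def V_eig_inv_def diag_mult diag_1)

definition P_W :: "nat \<Rightarrow> mpoly" where
  "P_W n = const_mpoly (V_eig_inv n) ** \<V> (P_tilde n)"

lemma op_V_P_tilde: "\<V> (P_tilde n) = const_mpoly (V_eig n) ** P_W n"
  unfolding P_W_def matrix_mul_assoc const_mpoly_mult[symmetric] V_eig_inverse const_mpoly_mat
  by (simp add: one_pCons[symmetric])

lemma op_V_P_tilde_entries:
  "\<V> (P_tilde n) $ 1 $ 1 = lin ((\<beta> - \<alpha>) / v) 1 * pderiv (jacobi_poly n) + lin ((v + 2 + \<alpha> + \<beta>) / 2) 0 * jacobi_poly n"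
  "\<V> (P_tilde n) $ 1 $ 2 = lin (1 + (\<beta> - \<alpha>) / v) 0 * pderiv (jacobi_poly n)"
  "\<V> (P_tilde n) $ 2 $ 1 = lin (1 + (\<alpha> - \<beta>) / v) 0 * pderiv (jacobi_poly n)"
  "\<V> (P_tilde n) $ 2 $ 2 = lin ((\<alpha> - \<beta>) / v) 1 * pderiv (jacobi_poly n) + lin ((- v + 2 + \<alpha> + \<beta>) / 2) 0 * jacobi_poly n"
  by (simp_all add: op_V_entries P_tilde_def mat_def)

lemma P_W_monic: "monic_of_degree n (P_W n)"
proof -
  have top_coeff: "coeff (jacobi_poly n) k = (if k = n then 1 else 0)" if "k \<ge> n" for k
    using jacobi_poly_props(1,2)[of n] that by (auto intro: coeff_eq_0)
  have "mpoly_coeff (\<V> (P_tilde n)) k = (if k = n then V_eig n else 0)" if "k \<ge> n" for k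
  proof -
    have d: "coeff (pderiv (jacobi_poly n)) k = 0"
      and d': "(if k = 0 then 0 else coeff (pderiv (jacobi_poly n)) (k - 1)) = (if k = n then of_nat n else 0)"
      using that by (auto simp: coeff_pderiv top_coeff)
    have "\<forall>i j. mpoly_coeff (\<V> (P_tilde n)) k $ i $ j = (if k = n then V_eig n else 0) $ i $ j"
      unfolding forall_2 mpoly_coeff_def vec_lambda_beta op_V_P_tilde_entries coeff_add coeff_lin_mult d d'
      by (simp add: top_coeff[OF that] V_eig_def diag_def V_eig1_def V_eig2_def)
    then show ?thesis by (simp add: vec_eq_iff)
  qed
  then show ?thesis
    by (simp add: monic_of_degree_def P_W_def mpoly_coeff_const_mult V_eig_inverse)
qed

lemma op_N_left_linear: "left_linear \<N>"
  by (simp add: op_N_def left_linear_diffop)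

lemma op_N_V_P_tilde: "\<N> (\<V> (P_tilde n)) = const_mpoly (diag (lam n - of_real root1) (lam n - of_real root2)) ** P_tilde n"
  unfolding vec_eq_iff forall_2 op_V_N_entries
  by (simp add: P_tilde_def mult_mat_entry const_mpoly_def diag_def, simp add: mat_def jacobi_poly_props(4) jacobi_op_0
      smult_diff_left)

lemma op_N_P_W: "\<N> (P_W n) = const_mpoly (N_eig n) ** P_tilde n"
proof -
  have "V_eig_inv n ** diag (lam n - of_real root1) (lam n - of_real root2) = N_eig n"
    unfolding eig_mult[symmetric] using eig_nonzero[of n] by (simp add: V_eig_inv_def N_eig_def diag_mult)
  then show ?thesis
    unfolding P_W_def left_linear_const[OF op_N_left_linear] op_N_V_P_tilde
    by (simp add: matrix_mul_assoc const_mpoly_mult[symmetric])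
qed

text \<open>
  Orthogonality and the squared norms of \<open>P_W\<close> are inherited from \<open>P_tilde\<close>: move \<open>\<V>\<close> to the other side, where it
  becomes \<open>\<N>\<close> and maps \<open>P_W n\<close> back to \<open>P_tilde n\<close>.
\<close>

lemma P_W_inner: "weight_inner (W \<alpha> \<beta> v) (P_W m) (P_W n)
  = V_eig_inv m ** (weight_inner (W_tilde \<alpha> \<beta>) (P_tilde m) (P_tilde n) ** (N_eig n ** adjoint_factor))"
proof -
  have "adjoint_mat (N_eig n ** adjoint_factor) = N_eig n ** adjoint_factor"
    by (simp add: N_eig_def adjoint_factor_def diag_def[symmetric] diag_mult adjoint_diag)
  moreover have "const_mpoly (N_eig n) ** P_tilde n ** const_mpoly adjoint_factor
      = const_mpoly (N_eig n ** adjoint_factor) ** P_tilde n"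
    unfolding P_tilde_def matrix_mul_assoc[symmetric] mat_commutes const_mpoly_mult ..
  ultimately show ?thesis
    unfolding P_W_def[of m] weight_inner_const_left[OF jacobi_weight_W] op_V_adjoint op_N_P_W
    by (simp add: weight_inner_const_right[OF jacobi_weight_W_tilde])
qed

lemma orthogonal_basis_W: "orthogonal_basis (W \<alpha> \<beta> v) P_W"
proof -
  have mo: "monic_orthogonal (W \<alpha> \<beta> v) P_W"
    unfolding monic_orthogonal_def P_W_inner
    using orthogonal_basis_W_tilde by (simp add: P_W_monic orthogonal_basis_def monic_orthogonal_def)
  \<comment> \<open>All factors of the squared norm are diagonal with nonzero entries.\<close>
  have "\<exists>C. weight_inner (W \<alpha> \<beta> v) (P_W n) (P_W n) ** C = mat 1" for n
  proof -
    define h where "h = jacobi_functional \<alpha> \<beta> ([:1, 0, -1:] * (jacobi_poly n * jacobi_poly n))"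
    define f1 f2 where "f1 = adjoint_factor $ 1 $ 1" and "f2 = adjoint_factor $ 2 $ 2"
    have f: "adjoint_factor = diag f1 f2"
      by (simp add: adjoint_factor_def f1_def f2_def diag_def)
    have "v + 2 + \<alpha> + \<beta> \<noteq> 0" "- v + 2 + \<alpha> + \<beta> \<noteq> 0" using v_upper by linarith+
    then have "f1 \<noteq> 0" "f2 \<noteq> 0"
      using v_nonzero v_plus v_minus
      unfolding f1_def f2_def adjoint_factor_def mat2_entries of_real_eq_0_iff by simp_all
    moreover have "h \<noteq> 0" using jacobi_poly_norm by (simp add: h_def)
    ultimately show ?thesis
      using eig_nonzero[of n] unfolding P_W_inner P_tilde_inner h_def[symmetric] f diag_mat V_eig_inv_def N_eig_def diag_mult
      by (intro exI[of _ "diag (of_real (V_eig1 n) / (h * of_real (N_eig1 n) * f1)) (of_real (V_eig2 n) / (h * of_real (N_eig2 n) * f2))"])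
        (simp add: diag_mult)
  qed
  then show ?thesis
    using mo monic_orthogonal_unique[OF jacobi_weight_W mo] unfolding orthogonal_basis_def by blast
qed

section \<open>Central operators and their eigenvalue polynomials\<close>

lemma op_in_diffops: "\<V> \<in> diffops" "\<N> \<in> diffops" "\<delta> \<in> diffops" "\<A> \<in> diffops"
  by (simp_all add: op_V_def op_N_def op_delta_def op_A_def diffops_add diffop_in_diffops)

lemma matrix_op_P_tilde: "matrix_op X (P_tilde n) = const_mpoly X ** P_tilde n"
  by (simp add: matrix_op_def P_tilde_def mat_commutes)

lemma op_delta_P_tilde: "\<delta> (P_tilde n) = const_mpoly (mat (lam n)) ** P_tilde n"
  by (simp add: vec_eq_iff op_delta_entry const_mpoly_mat mat_mult_entry,
      simp add: P_tilde_def mat_def jacobi_poly_props(4) jacobi_op_0)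

lemma op_A_P_tilde: "\<A> (P_tilde n) = const_mpoly (diag (lam n - of_real root2) (lam n - of_real root1)) ** P_tilde n"
  unfolding vec_eq_iff forall_2 op_A_entries
  by (simp add: P_tilde_def mult_mat_entry const_mpoly_def diag_def, simp add: mat_def jacobi_poly_props(4) jacobi_op_0
      smult_diff_left)

lemma weight_center_W_tilde_scalar:
  "D \<in> weight_center (W_tilde \<alpha> \<beta>) \<longleftrightarrow>
    D \<in> diffops \<and> (\<exists>d. \<forall>n. D (P_tilde n) = const_mpoly (mat (d n)) ** P_tilde n)"
  by (rule weight_center_iff[OF orthogonal_basis_W_tilde, of "matrix_op (mat2 0 1 0 0)" "\<lambda>_. 1"
        "matrix_op (mat2 0 0 1 0)" "\<lambda>_. 1"])
    (simp_all add: matrix_op_diffops matrix_op_P_tilde)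

text \<open>
  Every constant matrix, conjugated by the Darboux pair, gives an element of the algebra of \<open>W\<close>.
\<close>

lemma op_NXV_P_W: "(\<N> \<odot>\<^sub>o matrix_op X \<odot>\<^sub>o \<V>) (P_W n) = const_mpoly (N_eig n ** X ** V_eig n) ** P_W n"
  by (simp add: op_mult_def op_N_P_W diffops_const matrix_op_diffops op_in_diffops matrix_op_P_tilde op_V_P_tilde)
    (simp add: matrix_mul_assoc const_mpoly_mult)

lemma weight_center_W_scalar:
  "D \<in> weight_center (W \<alpha> \<beta> v) \<longleftrightarrow>
    D \<in> diffops \<and> (\<exists>d. \<forall>n. D (P_W n) = const_mpoly (mat (d n)) ** P_W n)"
proof (rule weight_center_iff[OF orthogonal_basis_W])
  let ?T = "\<lambda>X. \<N> \<odot>\<^sub>o matrix_op X \<odot>\<^sub>o \<V>"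
  show "?T X \<in> diffops" "?T X \<in> diffops" for X
    by (simp_all add: diffops_mult op_in_diffops matrix_op_diffops)
  have E12: "N_eig n ** mat2 0 1 0 0 ** V_eig n = mat2 0 (of_real (N_eig1 n) * of_real (V_eig2 n)) 0 0"
    and E21: "N_eig n ** mat2 0 0 1 0 ** V_eig n = mat2 0 0 (of_real (N_eig2 n) * of_real (V_eig1 n)) 0" for n
    by (simp_all add: N_eig_def V_eig_def diag_def vec_eq_iff forall_2 matrix_matrix_mult_def sum_2)
  show "?T (mat2 0 1 0 0) (P_W n) = const_mpoly (mat2 0 (of_real (N_eig1 n) * of_real (V_eig2 n)) 0 0) ** P_W n"
    and "?T (mat2 0 0 1 0) (P_W n) = const_mpoly (mat2 0 0 (of_real (N_eig2 n) * of_real (V_eig1 n)) 0) ** P_W n" for n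
    by (simp_all only: op_NXV_P_W E12 E21)
  show "complex_of_real (N_eig1 n) * of_real (V_eig2 n) \<noteq> 0" "complex_of_real (N_eig2 n) * of_real (V_eig1 n) \<noteq> 0" for n
    using eig_nonzero[of n] by simp_all
qed

text \<open>
  The derivatives of \<open>jacobi_poly n\<close> at 1 are polynomials in its eigenvalue up to the common factor
  \<open>poly (jacobi_poly n) 1\<close>, hence so is any combination of them.
\<close>

lemma diffop_at_1:
  "\<exists>g. \<forall>n. poly (diffop Fs (mat ((pderiv ^^ m) (jacobi_poly n))) $ i $ j) 1 = poly g (lam n) * poly (jacobi_poly n) 1"
proof (induction Fs arbitrary: m)
  case Nil
  then show ?case by (intro exI[of _ 0]) simp
next
  case (Cons F Fs)
  obtain g where g: "\<And>n. poly (diffop Fs (mat ((pderiv ^^ Suc m) (jacobi_poly n))) $ i $ j) 1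
      = poly g (lam n) * poly (jacobi_poly n) 1"
    using Cons.IH by blast
  show ?case
    using g eigenpoly_derivs_at_1[OF alpha_gt jacobi_poly_props(4)]
    by (intro exI[of _ "smult (poly (F $ i $ j) 1) (deriv_ratio \<alpha> \<beta> m) + g"])
      (simp add: mpoly_deriv_mat mat_mult_entry algebra_simps)
qed

lemma diffops_at_1:
  assumes "D \<in> diffops"
  obtains g where "\<And>n. poly (D (P_tilde n) $ i $ j) 1 = poly g (lam n) * poly (jacobi_poly n) 1"
  using assms diffop_at_1[of _ 0 i j] by (fastforce simp: diffops_def P_tilde_def)

lemma weight_center_W_tilde_iff: "D \<in> weight_center (W_tilde \<alpha> \<beta>) \<longleftrightarrow> (\<exists>q. acts_by lam P_tilde q D)"
proof
  assume "D \<in> weight_center (W_tilde \<alpha> \<beta>)"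
  then obtain d where D: "D \<in> diffops" and d: "\<And>n. D (P_tilde n) = const_mpoly (mat (d n)) ** P_tilde n"
    unfolding weight_center_W_tilde_scalar by blast
  obtain g where g: "\<And>n. poly (D (P_tilde n) $ 1 $ 1) 1 = poly g (lam n) * poly (jacobi_poly n) 1"
    using diffops_at_1[OF D] by blast
  have "d n = poly g (lam n)" for n
    using g[of n] jacobi_poly_at_1[of n] unfolding d
    by (simp add: const_mpoly_mat mat_mult_entry) (simp add: P_tilde_def mat_def)
  then show "\<exists>q. acts_by lam P_tilde q D" using D d by (auto simp: acts_by_def)
qed (auto simp: acts_by_def weight_center_W_tilde_scalar)

lemma weight_center_W_iff: "D \<in> weight_center (W \<alpha> \<beta> v) \<longleftrightarrow> (\<exists>q. acts_by lam P_W q D)"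
proof
  assume "D \<in> weight_center (W \<alpha> \<beta> v)"
  then obtain d where D: "D \<in> diffops" and d: "\<And>n. D (P_W n) = const_mpoly (mat (d n)) ** P_W n"
    unfolding weight_center_W_scalar by blast
  \<comment> \<open>The operator \<open>\<V> D\<close> acts on the scalar polynomials \<open>jacobi_poly n\<close>, whose derivatives at 1 are
    polynomials in \<open>\<lambda>\<^sub>n\<close>. In the first row of \<open>\<V> (P_tilde n)\<close> at 1 both entries contain the same
    multiple of the derivative; their difference is a nonzero constant times \<open>jacobi_poly n\<close>.\<close>
  have VD: "(\<V> \<odot>\<^sub>o D) (P_tilde n) = const_mpoly (mat (d n)) ** \<V> (P_tilde n)" for n
  proof -
    have "V_eig n ** mat (d n) = mat (d n) ** V_eig n" by (simp add: mat_commutes)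
    then show ?thesis
      by (simp add: op_mult_def op_V_P_tilde diffops_const D d matrix_mul_assoc const_mpoly_mult[symmetric])
  qed
  have "\<V> \<odot>\<^sub>o D \<in> diffops" using D op_in_diffops by (simp add: diffops_mult)
  then obtain g h where g: "\<And>n. poly ((\<V> \<odot>\<^sub>o D) (P_tilde n) $ 1 $ 1) 1 = poly g (lam n) * poly (jacobi_poly n) 1"
    and h: "\<And>n. poly ((\<V> \<odot>\<^sub>o D) (P_tilde n) $ 1 $ 2) 1 = poly h (lam n) * poly (jacobi_poly n) 1"
    using diffops_at_1 by metis
  define c where "c = complex_of_real ((v + 2 + \<alpha> + \<beta>) / 2)"
  have "v + 2 + \<alpha> + \<beta> > 0" using v_upper by linarith
  then have c: "c \<noteq> 0" unfolding c_def of_real_eq_0_iff by simp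
  have "d n = poly (smult (1 / c) (g - h)) (lam n)" for n
  proof -
    define b where "b = complex_of_real (1 + (\<beta> - \<alpha>) / v)"
    let ?p = "poly (jacobi_poly n) 1" and ?p' = "poly (pderiv (jacobi_poly n)) 1"
    have "poly (\<V> (P_tilde n) $ 1 $ 1) 1 = b * ?p' + c * ?p" "poly (\<V> (P_tilde n) $ 1 $ 2) 1 = b * ?p'"
      by (simp_all add: op_V_P_tilde_entries lin_def b_def c_def algebra_simps)
    then have "d n * (b * ?p' + c * ?p) = poly g (lam n) * ?p" "d n * (b * ?p') = poly h (lam n) * ?p"
      using g[of n] h[of n] unfolding VD
      by (simp_all add: const_mpoly_mat mat_mult_entry)
    then have "(d n * c) * ?p = (poly g (lam n) - poly h (lam n)) * ?p"
      by (simp add: algebra_simps)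
    then have "d n * c = poly g (lam n) - poly h (lam n)"
      using jacobi_poly_at_1[of n] by simp
    then show ?thesis using c by (simp add: field_simps)
  qed
  then show "\<exists>q. acts_by lam P_W q D" using D d unfolding acts_by_def by metis
qed (auto simp: acts_by_def weight_center_W_scalar)

text \<open>
  The operator is the polynomial \<open>q\<close> in \<open>\<delta>\<close>.
\<close>

lemma acts_by_P_tilde_exists: "\<exists>E. acts_by lam P_tilde q E"
proof (induction q rule: pCons_induct)
  case 0
  then show ?case using acts_by_scalar[of lam P_tilde 0] by auto
next
  case (pCons a q)
  then obtain E where E: "acts_by lam P_tilde q E" by blast
  have "acts_by lam P_tilde [:0, 1:] \<delta>"
    by (simp add: acts_by_def op_in_diffops op_delta_P_tilde)
  then have "acts_by lam P_tilde ([:a:] + [:0, 1:] * q) (op_scalar a \<oplus>\<^sub>o \<delta> \<odot>\<^sub>o E)"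
    by (intro acts_by_add acts_by_scalar acts_by_mult E)
  then show ?case by (intro exI) simp
qed

definition central_factor :: "complex poly" where
  "central_factor = [:- of_real root1, 1:] * [:- of_real root2, 1:]"

text \<open>
  On \<open>P_W n\<close>, the factors \<open>\<N>\<close> and \<open>\<V>\<close> contribute \<open>\<lambda>\<^sub>n - root1\<close> in the first row and \<open>\<lambda>\<^sub>n - root2\<close> in the second, and
  \<open>\<A>\<close> contributes the other one in each case. The result is a scalar, which is the purpose of \<open>\<A>\<close>.
\<close>

lemma acts_by_N_A_V:
  assumes E: "acts_by lam P_tilde q E"
  shows "acts_by lam P_W (central_factor * q) (\<N> \<odot>\<^sub>o E \<odot>\<^sub>o \<A> \<odot>\<^sub>o \<V>)"
proof -
  have Ed: "E \<in> diffops" and En: "\<And>n. E (P_tilde n) = const_mpoly (mat (poly q (lam n))) ** P_tilde n"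
    using E by (auto simp: acts_by_def)
  have "N_eig n ** mat (poly q (lam n)) ** diag (lam n - of_real root2) (lam n - of_real root1) ** V_eig n
      = mat (poly (central_factor * q) (lam n))" for n
  proof -
    have "of_real (N_eig1 n) * x * y * of_real (V_eig1 n) = (lam n - of_real root1) * y * x"
      and "of_real (N_eig2 n) * x * y * of_real (V_eig2 n) = (lam n - of_real root2) * y * x" for x y
      by (simp_all only: eig_mult[symmetric] ac_simps)
    note this[of "poly q (lam n)"]
    moreover have "poly (central_factor * q) (lam n)
        = (lam n - of_real root1) * (lam n - of_real root2) * poly q (lam n)"
      by (simp add: central_factor_def algebra_simps)
    ultimately show ?thesis
      unfolding V_eig_def N_eig_def diag_mat diag_mult by (simp only: mult.commute)
  qed
  then show ?thesis
    unfolding acts_by_def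
    by (intro conjI allI diffops_mult op_in_diffops Ed)
      (simp add: op_in_diffops Ed op_mult_def op_N_P_W diffops_const En op_A_P_tilde op_V_P_tilde,
       simp add: matrix_mul_assoc const_mpoly_mult[symmetric])
qed

section \<open>The condition at the two roots\<close>

definition V_symbol :: mpoly where
  "V_symbol = mat2 (lin ((\<beta> - \<alpha>) / v) 1) (lin (1 + (\<beta> - \<alpha>) / v) 0)
     (lin (1 + (\<alpha> - \<beta>) / v) 0) (lin ((\<alpha> - \<beta>) / v) 1)"

definition N_symbol :: mpoly where
  "N_symbol = mat2 (lin ((\<beta> - \<alpha>) / v) (- 1)) (lin (1 + (\<beta> - \<alpha>) / v) 0)
     (lin (1 + (\<alpha> - \<beta>) / v) 0) (lin ((\<alpha> - \<beta>) / v) (- 1))"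

definition V_const :: cmatrix where
  "V_const = diag (of_real ((v + 2 + \<alpha> + \<beta>) / 2)) (of_real ((- v + 2 + \<alpha> + \<beta>) / 2))"

lemma op_V_apply: "\<V> P = P ** const_mpoly V_const + mpoly_deriv P ** V_symbol"
proof -
  have "const_mpoly V_const = mat2 (lin ((v + 2 + \<alpha> + \<beta>) / 2) 0) 0 0 (lin ((- v + 2 + \<alpha> + \<beta>) / 2) 0)"
    by (simp add: const_mpoly_def V_const_def diag_def vec_eq_iff forall_2 lin_def)
  then show ?thesis by (simp add: op_V_def V_symbol_def)
qed

lemma symbol_V: "has_symbol 1 V_symbol \<V>"
  unfolding has_symbol_def V_symbol_def op_V_def
  by (intro exI[of _ "[mat2 (lin ((v + 2 + \<alpha> + \<beta>) / 2) 0) 0 0 (lin ((- v + 2 + \<alpha> + \<beta>) / 2) 0)]"]) simp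

lemma symbol_N: "has_symbol 1 N_symbol \<N>"
  unfolding has_symbol_def N_symbol_def op_N_def
  by (intro exI[of _ "[mat2 (lin (- (1/2) * (- v + 4 + \<alpha> + \<beta>)) 0) 0
           0 (lin (- (1/2) * (\<alpha> + \<beta> + v + 4)) 0)]"]) simp

lemma symbol_delta: "has_symbol 2 (mat [:1, 0, -1:]) \<delta>"
  unfolding has_symbol_def op_delta_def
  by (intro exI[of _ "[0, mat (lin (\<beta> - \<alpha>) (- (\<alpha> + \<beta> + 4)))]"]) simp

lemma symbol_A: "has_symbol 2 (mat [:1, 0, -1:]) \<A>"
proof -
  have "has_symbol 0 F (diffop [F])" for F by (simp add: has_symbol_0_iff fun_eq_iff)
  then have "has_symbol 2 (mat [:1, 0, -1:] + 0) \<A>"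
    unfolding op_A_def by (intro has_symbol_add symbol_delta has_symbol_less[where m = 0]) auto
  then show ?thesis by simp
qed

lemma N_V_symbol: "N_symbol ** V_symbol = mat [:1, 0, -1:]"
proof -
  define b where "b = (\<beta> - \<alpha>) / v"
  have b: "(\<alpha> - \<beta>) / v = - b" by (simp add: b_def minus_divide_left)
  show ?thesis
    unfolding N_symbol_def V_symbol_def b_def[symmetric] b vec_eq_iff forall_2
    by (intro conjI poly_eqI_eval)
      (simp_all add: matrix_matrix_mult_def sum_2 mat_def lin_def algebra_simps)
qed

text \<open>
  The leading coefficient of \<open>\<V>\<close> is invertible away from the endpoints, its inverse being that of \<open>\<N>\<close>
  divided by \<open>1 - x\<^sup>2\<close>.
\<close>

lemma V_symbol_cancel:
  fixes G :: mpoly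
  assumes "V_symbol ** G = 0"
  shows "G = 0"
proof -
  have "mat [:1, 0, -1:] ** G = 0"
    using arg_cong[OF assms, of "\<lambda>M. N_symbol ** M"] by (simp add: matrix_mul_assoc N_V_symbol)
  then have "[:1, 0, -1:] * G $ i $ j = 0" for i j
    using mat_mult_entry[of "[:1, 0, -1:]" G i j] by simp
  then show ?thesis by (simp add: vec_eq_iff del: mult_pCons_left)
qed

text \<open>
  A constant matrix on the left of \<open>\<V>\<close> can only be compensated on the right by an operator of order
  zero.
\<close>

lemma order_0_of_intertwines:
  assumes D: "D \<in> diffops" and K: "\<V> \<odot>\<^sub>o D = matrix_op X \<odot>\<^sub>o \<V>"
  obtains H where "has_symbol 0 H D"
proof -
  have KV: "has_symbol 1 (const_mpoly X ** V_symbol) (matrix_op X \<odot>\<^sub>o \<V>)"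
    using has_symbol_op_mult[OF _ symbol_V, of 0 "const_mpoly X" "matrix_op X"]
    by (simp add: has_symbol_0_iff matrix_op_def fun_eq_iff)
  have "\<exists>H. has_symbol 0 H D" if "has_symbol m G D" for m G
    using that
  proof (induction m arbitrary: G)
    case (Suc m)
    \<comment> \<open>The right-hand side has order one, so a positive order of \<open>D\<close> would be visible.\<close>
    have "has_symbol (1 + Suc m) (V_symbol ** G) (\<V> \<odot>\<^sub>o D)"
      by (rule has_symbol_op_mult[OF symbol_V Suc.prems])
    moreover have "has_symbol (1 + Suc m) 0 (\<V> \<odot>\<^sub>o D)"
      unfolding K by (rule has_symbol_less[OF KV]) simp
    ultimately have "G = 0"
      using has_symbol_unique V_symbol_cancel by blast
    then show ?case
      using Suc has_symbol_drop by metis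
  qed blast
  then show ?thesis
    using diffops_has_symbol[OF D] that by metis
qed

text \<open>
  The intertwiner must be multiplication by the same diagonal matrix, and this commutes with the leading
  coefficient of \<open>\<V>\<close>. The off-diagonal entries \<open>1 \<plusminus> (\<beta> - \<alpha>) / v\<close> do not vanish, so the matrix is scalar.
\<close>

lemma intertwining_diag_scalar:
  assumes D: "D \<in> diffops" and K: "\<V> \<odot>\<^sub>o D = matrix_op (diag k1 k2) \<odot>\<^sub>o \<V>"
  shows "k1 = k2"
proof -
  let ?K = "const_mpoly (diag k1 k2)"
  obtain H where H: "D = (\<lambda>P. P ** H)"
    using order_0_of_intertwines[OF D K] has_symbol_0_iff by metis
  have eq: "(P ** const_mpoly V_const + mpoly_deriv P ** V_symbol) ** H
      = P ** ?K ** const_mpoly V_const + mpoly_deriv (P ** ?K) ** V_symbol" for P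
    using fun_cong[OF K, of P] by (simp add: op_mult_def H op_V_apply matrix_op_def)
  have const_deriv: "mpoly_deriv (const_mpoly C) = 0" for C
    by (simp add: mpoly_deriv_def const_mpoly_def vec_eq_iff pderiv_pCons)
  have mat1: "mat 1 = const_mpoly (mat 1)" by (simp add: const_mpoly_mat one_pCons)
  have commute: "?K ** const_mpoly V_const = const_mpoly V_const ** ?K"
    unfolding const_mpoly_mult[symmetric] V_const_def diag_mult by (simp add: mult.commute)
  \<comment> \<open>On constants only the invertible term of order zero of \<open>\<V>\<close> survives and fixes \<open>H\<close>;
    on the identity function the leading coefficient has to commute with it.\<close>
  have "const_mpoly V_const ** H = const_mpoly V_const ** ?K"
    using eq[of "mat 1"] unfolding matrix_mul_lid commute const_deriv
    by (simp add: mat1 const_deriv)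
  moreover have "diag (of_real (2 / (v + 2 + \<alpha> + \<beta>))) (of_real (2 / (- v + 2 + \<alpha> + \<beta>))) ** V_const = mat 1"
  proof -
    have "v + 2 + \<alpha> + \<beta> \<noteq> 0" "- v + 2 + \<alpha> + \<beta> \<noteq> 0" using v_upper by linarith+
    then have "2 / (v + 2 + \<alpha> + \<beta>) * ((v + 2 + \<alpha> + \<beta>) / 2) = 1"
      "2 / (- v + 2 + \<alpha> + \<beta>) * ((- v + 2 + \<alpha> + \<beta>) / 2) = 1" by simp_all
    then show ?thesis
      unfolding V_const_def diag_mult of_real_mult[symmetric] by (simp only: of_real_1 diag_1)
  qed
  ultimately have HK: "H = ?K"
    by (metis const_mpoly_mult matrix_mul_assoc matrix_mul_lid mat1)
  have "V_symbol ** ?K = ?K ** V_symbol"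
  proof -
    let ?X = "mat [:0, 1:] :: mpoly"
    have "mpoly_deriv ?X = mat 1" by (simp add: mpoly_deriv_mat pderiv_pCons one_pCons)
    moreover have "mpoly_deriv (?X ** ?K) = ?K"
      by (simp add: mpoly_deriv_mult calculation const_deriv)
    ultimately show ?thesis
      using eq[of ?X] commute by (simp add: HK matrix_add_rdistrib matrix_mul_assoc[symmetric])
  qed
  then have "(V_symbol ** ?K) $ 1 $ 2 = (?K ** V_symbol) $ 1 $ 2" by simp
  then have "complex_of_real (1 + (\<beta> - \<alpha>) / v) * k2 = of_real (1 + (\<beta> - \<alpha>) / v) * k1"
    by (simp add: V_symbol_def const_mpoly_def diag_def matrix_matrix_mult_def sum_2 lin_def mult.commute)
  moreover have "1 + (\<beta> - \<alpha>) / v = (v - \<alpha> + \<beta>) / v"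
    using v_nonzero by (simp add: field_simps)
  then have "complex_of_real (1 + (\<beta> - \<alpha>) / v) \<noteq> 0"
    unfolding of_real_eq_0_iff using v_nonzero v_minus by simp
  ultimately show ?thesis by simp
qed

text \<open>
  This is the only obstruction for a polynomial in \<open>\<delta>\<close> to descend to the algebra of \<open>W\<close>. Rows in the
  kernel of \<open>\<V>\<close> have components in the eigenspaces of \<open>\<delta>\<close> for \<open>root1\<close> and \<open>root2\<close>, and these kernel elements couple
  the two components; the proof expresses this coupling through operators instead of solutions.
\<close>

lemma eigenvalue_equal_at_roots:
  assumes "acts_by lam P_W q D"
  shows "poly q (of_real root1) = poly q (of_real root2)"
proof -
  have D: "D \<in> diffops" and Dn: "\<And>n. D (P_W n) = const_mpoly (mat (poly q (lam n))) ** P_W n"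
    using assms by (auto simp: acts_by_def)
  let ?k1 = "poly q (of_real root1)" and ?k2 = "poly q (of_real root2)"
  have split: "\<exists>g. q = [:poly q c:] + [:- c, 1:] * g" for c
  proof -
    have "poly (q - [:poly q c:]) c = 0" by simp
    then obtain g where "q - [:poly q c:] = [:- c, 1:] * g"
      using poly_eq_0_iff_dvd by (metis dvdE)
    then show ?thesis by (intro exI[of _ g]) (simp add: algebra_simps del: mult_pCons_left)
  qed
  obtain g1 g2 where q1: "q = [:?k1:] + [:- of_real root1, 1:] * g1"
    and q2: "q = [:?k2:] + [:- of_real root2, 1:] * g2"
    using split by metis
  have q1n: "poly q (lam n) = ?k1 + (lam n - of_real root1) * poly g1 (lam n)" for n
    using arg_cong[OF q1, of "\<lambda>p. poly p (lam n)"] by (simp add: algebra_simps)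
  have q2n: "poly q (lam n) = ?k2 + (lam n - of_real root2) * poly g2 (lam n)" for n
    using arg_cong[OF q2, of "\<lambda>p. poly p (lam n)"] by (simp add: algebra_simps)
  obtain E1 E2 where E: "acts_by lam P_tilde g1 E1" "acts_by lam P_tilde g2 E2"
    using acts_by_P_tilde_exists by metis
  define G where "G = E1 \<odot>\<^sub>o matrix_op (diag 1 0) \<oplus>\<^sub>o E2 \<odot>\<^sub>o matrix_op (diag 0 1)"
  have diag_add: "const_mpoly (diag a 0) ** P + const_mpoly (diag 0 b) ** P = const_mpoly (diag a b) ** P" for a b and P :: mpoly
    by (simp only: matrix_add_rdistrib[symmetric] const_mpoly_add[symmetric] diag_plus add_0_left add_0_right)
  have Gd: "G \<in> diffops"
    using E by (simp add: G_def acts_by_def diffops_add diffops_mult matrix_op_diffops)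
  have Gn: "G (P_tilde n) = const_mpoly (diag (poly g1 (lam n)) (poly g2 (lam n))) ** P_tilde n" for n
  proof -
    have "E1 (P_tilde n) = const_mpoly (mat (poly g1 (lam n))) ** P_tilde n"
      and "E2 (P_tilde n) = const_mpoly (mat (poly g2 (lam n))) ** P_tilde n"
      using E by (auto simp: acts_by_def)
    then have "G (P_tilde n) = const_mpoly (mat (poly g1 (lam n)) ** diag 1 0) ** P_tilde n
        + const_mpoly (mat (poly g2 (lam n)) ** diag 0 1) ** P_tilde n"
      by (simp add: G_def op_add_def op_mult_def diffops_const matrix_op_diffops matrix_op_P_tilde,
          simp add: const_mpoly_mult matrix_mul_assoc)
    then show ?thesis by (simp add: diag_mat diag_mult diag_add)
  qed
  \<comment> \<open>On \<open>P_tilde n\<close>, applying \<open>\<V>\<close> and then \<open>D\<close> multiplies \<open>\<V> (P_tilde n)\<close> by \<open>q(\<lambda>\<^sub>n)\<close>. The correction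
    \<open>\<N> G \<V>\<close> subtracts the multiples of \<open>\<lambda>\<^sub>n - root1\<close> and \<open>\<lambda>\<^sub>n - root2\<close> in the two rows, because \<open>\<N>\<close>
    undoes \<open>\<V>\<close> up to these factors. What is left are the two values of \<open>q\<close>.\<close>
  define R where "R = D \<oplus>\<^sub>o op_scalar (-1) \<odot>\<^sub>o (\<N> \<odot>\<^sub>o G \<odot>\<^sub>o \<V>)"
  have sc: "op_scalar c \<in> diffops" for c
    using acts_by_scalar[of lam P_tilde c] by (simp add: acts_by_def)
  have Rd: "R \<in> diffops"
    unfolding R_def by (intro diffops_add diffops_mult D Gd op_in_diffops sc)
  have "\<V> \<odot>\<^sub>o R = matrix_op (diag ?k1 ?k2) \<odot>\<^sub>o \<V>"
  proof (rule left_linear_ext[OF _ _ P_tilde_monic])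
    show "left_linear (\<V> \<odot>\<^sub>o R)" "left_linear (matrix_op (diag ?k1 ?k2) \<odot>\<^sub>o \<V>)"
      by (intro left_linear_diffops diffops_mult op_in_diffops Rd matrix_op_diffops)+
    fix n
    have "(\<V> \<odot>\<^sub>o R) (P_tilde n) = const_mpoly (V_eig n ** mat (poly q (lam n))) ** P_W n
      + const_mpoly (mat (-1) ** V_eig n ** N_eig n ** diag (poly g1 (lam n)) (poly g2 (lam n)) ** V_eig n) ** P_W n"
      by (simp add: R_def op_add_def op_mult_def op_V_P_tilde diffops_const D sc Dn op_scalar_apply op_N_P_W
          Gn Gd op_in_diffops, simp add: const_mpoly_mult matrix_mul_assoc)
    also have "\<dots> = const_mpoly (V_eig n ** mat (poly q (lam n))
      + mat (-1) ** V_eig n ** N_eig n ** diag (poly g1 (lam n)) (poly g2 (lam n)) ** V_eig n) ** P_W n"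
      by (simp only: matrix_add_rdistrib const_mpoly_add)
    also have "V_eig n ** mat (poly q (lam n))
      + mat (-1) ** V_eig n ** N_eig n ** diag (poly g1 (lam n)) (poly g2 (lam n)) ** V_eig n = diag ?k1 ?k2 ** V_eig n"
    proof -
      have "of_real (V_eig1 n) * poly q (lam n)
          + -1 * of_real (V_eig1 n) * of_real (N_eig1 n) * poly g1 (lam n) * of_real (V_eig1 n) = ?k1 * of_real (V_eig1 n)"
        unfolding q1n eig_mult[symmetric] by (simp add: algebra_simps)
      moreover have "of_real (V_eig2 n) * poly q (lam n)
          + -1 * of_real (V_eig2 n) * of_real (N_eig2 n) * poly g2 (lam n) * of_real (V_eig2 n) = ?k2 * of_real (V_eig2 n)"
        unfolding q2n eig_mult[symmetric] by (simp add: algebra_simps)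
      ultimately show ?thesis
        unfolding V_eig_def N_eig_def diag_mat diag_mult diag_plus by (simp only:)
    qed
    also have "const_mpoly (diag ?k1 ?k2 ** V_eig n) ** P_W n = (matrix_op (diag ?k1 ?k2) \<odot>\<^sub>o \<V>) (P_tilde n)"
      by (simp add: op_mult_def matrix_op_P_tilde diffops_const op_in_diffops op_V_P_tilde,
          simp add: const_mpoly_mult matrix_mul_assoc)
    finally show "(\<V> \<odot>\<^sub>o R) (P_tilde n) = (matrix_op (diag ?k1 ?k2) \<odot>\<^sub>o \<V>) (P_tilde n)" .
  qed
  then show ?thesis by (rule intertwining_diag_scalar[OF Rd])
qed

lemma weight_center_W_iff_factor:
  "D \<in> weight_center (W \<alpha> \<beta> v) \<longleftrightarrow> (\<exists>c p. acts_by lam P_W ([:c:] + central_factor * p) D)"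
proof
  assume "D \<in> weight_center (W \<alpha> \<beta> v)"
  then obtain q where q: "acts_by lam P_W q D" using weight_center_W_iff by blast
  define r where "r = q - [:poly q (of_real root1):]"
  have "poly r (of_real root1) = 0" "poly r (of_real root2) = 0"
    using eigenvalue_equal_at_roots[OF q] by (simp_all add: r_def)
  have ne: "complex_of_real root1 \<noteq> of_real root2"
    using root_diff v_nonzero by auto
  obtain s where s: "r = [:- of_real root1, 1:] * s"
    using \<open>poly r (of_real root1) = 0\<close> poly_eq_0_iff_dvd by (metis dvdE)
  have "poly s (of_real root2) = 0"
    using \<open>poly r (of_real root2) = 0\<close> ne by (simp add: s)
  then obtain p where "s = [:- of_real root2, 1:] * p"
    using poly_eq_0_iff_dvd by (metis dvdE)
  then have "r = central_factor * p"
    by (simp only: s central_factor_def mult.assoc)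
  then have "q = [:poly q (of_real root1):] + central_factor * p" by (simp add: r_def algebra_simps)
  then show "\<exists>c p. acts_by lam P_W ([:c:] + central_factor * p) D" using q by metis
qed (use weight_center_W_iff in blast)

section \<open>Direct sum, generators and orders\<close>

lemma weight_center_W_eq:
  "weight_center (W \<alpha> \<beta> v) = {D \<oplus>\<^sub>o E | D E. D \<in> range op_scalar \<and>
    E \<in> {\<N> \<odot>\<^sub>o E \<odot>\<^sub>o \<A> \<odot>\<^sub>o \<V> | E. E \<in> weight_center (W_tilde \<alpha> \<beta>)}}"
proof (intro set_eqI iffI)
  fix D assume "D \<in> weight_center (W \<alpha> \<beta> v)"
  then obtain c p where D: "acts_by lam P_W ([:c:] + central_factor * p) D"
    using weight_center_W_iff_factor by blast
  obtain E where E: "acts_by lam P_tilde p E" using acts_by_P_tilde_exists by blast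
  have "acts_by lam P_W ([:c:] + central_factor * p) (op_scalar c \<oplus>\<^sub>o (\<N> \<odot>\<^sub>o E \<odot>\<^sub>o \<A> \<odot>\<^sub>o \<V>))"
    by (intro acts_by_add acts_by_scalar acts_by_N_A_V E)
  then have "D = op_scalar c \<oplus>\<^sub>o (\<N> \<odot>\<^sub>o E \<odot>\<^sub>o \<A> \<odot>\<^sub>o \<V>)"
    using acts_by_op_unique[OF P_W_monic D] by blast
  moreover have "E \<in> weight_center (W_tilde \<alpha> \<beta>)"
    using E weight_center_W_tilde_iff by blast
  ultimately show "D \<in> {D \<oplus>\<^sub>o E | D E. D \<in> range op_scalar \<and>
    E \<in> {\<N> \<odot>\<^sub>o E \<odot>\<^sub>o \<A> \<odot>\<^sub>o \<V> | E. E \<in> weight_center (W_tilde \<alpha> \<beta>)}}" by blast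
next
  fix D assume "D \<in> {D \<oplus>\<^sub>o E | D E. D \<in> range op_scalar \<and>
    E \<in> {\<N> \<odot>\<^sub>o E \<odot>\<^sub>o \<A> \<odot>\<^sub>o \<V> | E. E \<in> weight_center (W_tilde \<alpha> \<beta>)}}"
  then obtain c E where E: "E \<in> weight_center (W_tilde \<alpha> \<beta>)"
    and D: "D = op_scalar c \<oplus>\<^sub>o (\<N> \<odot>\<^sub>o E \<odot>\<^sub>o \<A> \<odot>\<^sub>o \<V>)" by blast
  obtain p where "acts_by lam P_tilde p E" using E weight_center_W_tilde_iff by blast
  then have "acts_by lam P_W ([:c:] + central_factor * p) D"
    unfolding D by (intro acts_by_add acts_by_scalar acts_by_N_A_V)
  then show "D \<in> weight_center (W \<alpha> \<beta> v)" using weight_center_W_iff by blast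
qed

lemma direct_sum_trivial_intersection:
  "range op_scalar \<inter> {\<N> \<odot>\<^sub>o E \<odot>\<^sub>o \<A> \<odot>\<^sub>o \<V> | E. E \<in> weight_center (W_tilde \<alpha> \<beta>)} = {op_zero}"
proof (intro equalityI subsetI)
  fix D assume "D \<in> range op_scalar \<inter> {\<N> \<odot>\<^sub>o E \<odot>\<^sub>o \<A> \<odot>\<^sub>o \<V> | E. E \<in> weight_center (W_tilde \<alpha> \<beta>)}"
  then obtain c E where c: "D = op_scalar c" and E: "E \<in> weight_center (W_tilde \<alpha> \<beta>)"
    and D: "D = \<N> \<odot>\<^sub>o E \<odot>\<^sub>o \<A> \<odot>\<^sub>o \<V>" by blast
  obtain p where "acts_by lam P_tilde p E" using E weight_center_W_tilde_iff by blast
  then have "acts_by lam P_W (central_factor * p) D" unfolding D by (rule acts_by_N_A_V)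
  moreover have "acts_by lam P_W [:c:] D" unfolding c by (rule acts_by_scalar)
  ultimately have "[:c:] = central_factor * p"
    using acts_by_poly_unique[OF inj_lam P_W_monic] by blast
  from arg_cong[OF this, of "\<lambda>q. poly q (of_real root1)"] have "c = 0"
    unfolding central_factor_def poly_mult by simp
  then show "D \<in> {op_zero}" by (simp add: c op_scalar_0)
next
  fix D assume "D \<in> {op_zero}"
  then have D: "D = op_scalar 0" by (simp add: op_scalar_0)
  have "acts_by lam P_W (central_factor * [:0:]) (\<N> \<odot>\<^sub>o op_scalar 0 \<odot>\<^sub>o \<A> \<odot>\<^sub>o \<V>)"
    by (intro acts_by_N_A_V acts_by_scalar)
  moreover have "acts_by lam P_W [:0:] D" unfolding D by (rule acts_by_scalar)
  ultimately have "D = \<N> \<odot>\<^sub>o op_scalar 0 \<odot>\<^sub>o \<A> \<odot>\<^sub>o \<V>"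
    using acts_by_op_unique[OF P_W_monic, of lam 0] by simp
  moreover have "op_scalar 0 \<in> weight_center (W_tilde \<alpha> \<beta>)"
    using acts_by_scalar weight_center_W_tilde_iff by blast
  ultimately show "D \<in> range op_scalar \<inter> {\<N> \<odot>\<^sub>o E \<odot>\<^sub>o \<A> \<odot>\<^sub>o \<V> | E. E \<in> weight_center (W_tilde \<alpha> \<beta>)}"
    using D by blast
qed

lemma acts_by_Z1: "acts_by lam P_W central_factor (Z1 \<alpha> \<beta> v)"
proof -
  have "op_scalar 1 = id"
    by (simp add: fun_eq_iff op_scalar_apply const_mpoly_mat vec_eq_iff mat_mult_entry)
  then have "\<N> \<odot>\<^sub>o op_scalar 1 = \<N>" by (simp add: op_mult_def fun_eq_iff)
  then show ?thesis
    using acts_by_N_A_V[OF acts_by_scalar[of _ _ 1]] by (simp add: Z1_def)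
qed

lemma acts_by_Z2: "acts_by lam P_W (central_factor * [:0, 1:]) (Z2 \<alpha> \<beta> v)"
  unfolding Z2_def
  by (rule acts_by_N_A_V) (simp add: acts_by_def op_in_diffops op_delta_P_tilde)

text \<open>
  Multiplication by \<open>Z\<^sub>1\<close> raises the degree of \<open>p\<close> by two, so the recursion needs the degrees zero and one
  to start from; these are \<open>Z\<^sub>1\<close> and \<open>Z\<^sub>2\<close> themselves.
\<close>

lemma generated_algebra_factor_multiples:
  defines "G \<equiv> generated_algebra {op_scalar 1, Z1 \<alpha> \<beta> v, Z2 \<alpha> \<beta> v}"
  shows "\<exists>D\<in>G. acts_by lam P_W (central_factor * p) D"
proof -
  have Z1: "Z1 \<alpha> \<beta> v \<in> G" and Z2: "Z2 \<alpha> \<beta> v \<in> G"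
    unfolding G_def by (auto intro: generated_algebra.gen)
  define e0 e1 where "e0 = complex_of_real root1 * of_real root2"
    and "e1 = complex_of_real root1 + of_real root2"
  have cf: "central_factor = [:e0, - e1, 1:]"
    by (simp add: central_factor_def e0_def e1_def algebra_simps)
  \<comment> \<open>Since \<open>x\<^sup>2 = q + e\<^sub>1 x - e\<^sub>0\<close> for the central factor \<open>q\<close>, the operator with eigenvalue
    \<open>q x\<^sup>k\<^sup>+\<^sup>2\<close> comes from those with \<open>q x\<^sup>k\<^sup>+\<^sup>1\<close> and \<open>q x\<^sup>k\<close>: multiply the latter by \<open>Z\<^sub>1\<close>.\<close>
  have mon: "(\<exists>D\<in>G. acts_by lam P_W (central_factor * [:0, 1:] ^ k) D) \<and>
      (\<exists>D\<in>G. acts_by lam P_W (central_factor * [:0, 1:] ^ Suc k) D)" for k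
  proof (induction k)
    case 0
    show ?case using Z1 Z2 acts_by_Z1 acts_by_Z2 by auto
  next
    case (Suc k)
    then obtain D E where D: "D \<in> G" "acts_by lam P_W (central_factor * [:0, 1:] ^ k) D"
      and E: "E \<in> G" "acts_by lam P_W (central_factor * [:0, 1:] ^ Suc k) E" by blast
    let ?F = "Z1 \<alpha> \<beta> v \<odot>\<^sub>o D \<oplus>\<^sub>o op_scalar e1 \<odot>\<^sub>o E \<oplus>\<^sub>o op_scalar (- e0) \<odot>\<^sub>o D"
    have "?F \<in> G"
      using D(1) E(1) Z1 unfolding G_def
      by (intro generated_algebra.add generated_algebra.scale generated_algebra.mult)
    moreover have "acts_by lam P_W (central_factor * (central_factor * [:0, 1:] ^ k)
        + [:e1:] * (central_factor * [:0, 1:] ^ Suc k) + [:- e0:] * (central_factor * [:0, 1:] ^ k)) ?F"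
      by (intro acts_by_add acts_by_mult acts_by_scalar acts_by_Z1 D(2) E(2))
    moreover have "central_factor * (central_factor * [:0, 1:] ^ k)
        + [:e1:] * (central_factor * [:0, 1:] ^ Suc k) + [:- e0:] * (central_factor * [:0, 1:] ^ k)
        = central_factor * [:0, 1:] ^ Suc (Suc k)"
    proof -
      have "central_factor + [:e1:] * [:0, 1:] + [:- e0:] = [:0, 1:] * [:0, 1:]"
        by (simp add: cf)
      then have "central_factor * ([:0, 1:] ^ k * (central_factor + [:e1:] * [:0, 1:] + [:- e0:]))
          = central_factor * ([:0, 1:] ^ k * ([:0, 1:] * [:0, 1:]))" by (simp only:)
      then show ?thesis
        by (simp only: ring_distribs power_Suc ac_simps)
    qed
    ultimately show ?case using E by metis
  qed
  have "\<exists>D\<in>G. acts_by lam P_W (central_factor * (\<Sum>i<n. [:coeff p i:] * [:0, 1:] ^ i)) D" for n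
  proof (induction n)
    case 0
    have "op_zero \<in> G" unfolding G_def by (rule generated_algebra.zero)
    moreover have "acts_by lam P_W 0 op_zero"
      using acts_by_scalar[of lam P_W 0] by (simp add: op_scalar_0)
    ultimately show ?case by auto
  next
    case (Suc n)
    then obtain D where D: "D \<in> G" "acts_by lam P_W (central_factor * (\<Sum>i<n. [:coeff p i:] * [:0, 1:] ^ i)) D"
      by blast
    obtain E where E: "E \<in> G" "acts_by lam P_W (central_factor * [:0, 1:] ^ n) E"
      using mon by blast
    have "D \<oplus>\<^sub>o op_scalar (coeff p n) \<odot>\<^sub>o E \<in> G"
      using D(1) E(1) unfolding G_def by (intro generated_algebra.add generated_algebra.scale)
    moreover have "acts_by lam P_W (central_factor * (\<Sum>i<n. [:coeff p i:] * [:0, 1:] ^ i)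
        + [:coeff p n:] * (central_factor * [:0, 1:] ^ n)) (D \<oplus>\<^sub>o op_scalar (coeff p n) \<odot>\<^sub>o E)"
      by (intro acts_by_add acts_by_mult acts_by_scalar D(2) E(2))
    moreover have "central_factor * (\<Sum>i<n. [:coeff p i:] * [:0, 1:] ^ i)
        + [:coeff p n:] * (central_factor * [:0, 1:] ^ n)
        = central_factor * (\<Sum>i<Suc n. [:coeff p i:] * [:0, 1:] ^ i)"
      by (simp only: sum.lessThan_Suc ring_distribs ac_simps)
    ultimately show ?case by metis
  qed
  from this[of "Suc (degree p)"] show ?thesis
    using poly_as_sum_of_monoms[of p] by (simp add: monom_altdef lessThan_Suc_atMost)
qed

lemma weight_center_W_generated:
  "weight_center (W \<alpha> \<beta> v) = generated_algebra {op_scalar 1, Z1 \<alpha> \<beta> v, Z2 \<alpha> \<beta> v}" (is "_ = ?G")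
proof (intro equalityI subsetI)
  fix D assume "D \<in> ?G"
  then have "\<exists>q. acts_by lam P_W q D"
  proof (rule generated_algebra_acts_by)
    show "\<exists>q. acts_by lam P_W q E" if "E \<in> {op_scalar 1, Z1 \<alpha> \<beta> v, Z2 \<alpha> \<beta> v}" for E
      using that acts_by_scalar acts_by_Z1 acts_by_Z2 by blast
  qed
  then show "D \<in> weight_center (W \<alpha> \<beta> v)" using weight_center_W_iff by blast
next
  fix D assume "D \<in> weight_center (W \<alpha> \<beta> v)"
  then obtain c p where D: "acts_by lam P_W ([:c:] + central_factor * p) D"
    using weight_center_W_iff_factor by blast
  obtain E where E: "E \<in> ?G" "acts_by lam P_W (central_factor * p) E"
    using generated_algebra_factor_multiples by blast
  have "op_scalar 1 \<in> ?G" by (rule generated_algebra.gen) simp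
  then have "op_scalar c \<odot>\<^sub>o op_scalar 1 \<oplus>\<^sub>o E \<in> ?G"
    by (intro generated_algebra.add generated_algebra.scale E(1))
  moreover have "acts_by lam P_W ([:c:] * [:1:] + central_factor * p) (op_scalar c \<odot>\<^sub>o op_scalar 1 \<oplus>\<^sub>o E)"
    by (intro acts_by_add acts_by_mult acts_by_scalar E(2))
  then have "D = op_scalar c \<odot>\<^sub>o op_scalar 1 \<oplus>\<^sub>o E"
    using acts_by_op_unique[OF P_W_monic D] by simp
  ultimately show "D \<in> ?G" by simp
qed

lemma N_mat_V_symbol: "N_symbol ** mat p ** V_symbol = mat (p * [:1, 0, -1:])"
proof -
  have "N_symbol ** mat p ** V_symbol = mat p ** (N_symbol ** V_symbol)"
    by (simp only: mat_commutes[of p N_symbol, symmetric] matrix_mul_assoc)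
  then show ?thesis by (simp only: N_V_symbol mat_mult_mat)
qed

lemma order_Z1: "op_order (Z1 \<alpha> \<beta> v) = 4"
proof (rule op_order_eqI)
  have "has_symbol (1 + 2 + 1) (N_symbol ** mat [:1, 0, -1:] ** V_symbol) (Z1 \<alpha> \<beta> v)"
    unfolding Z1_def by (intro has_symbol_op_mult symbol_N symbol_A symbol_V)
  moreover have order: "1 + 2 + 1 = (4 :: nat)" by simp
  ultimately show "has_symbol 4 (mat ([:1, 0, -1:] * [:1, 0, -1:])) (Z1 \<alpha> \<beta> v)"
    unfolding N_mat_V_symbol by (simp only:)
qed (intro mat_poly_nonzero, simp)

lemma order_Z2: "op_order (Z2 \<alpha> \<beta> v) = 6"
proof (rule op_order_eqI)
  have "has_symbol (1 + 2 + 2 + 1) (N_symbol ** mat [:1, 0, -1:] ** mat [:1, 0, -1:] ** V_symbol) (Z2 \<alpha> \<beta> v)"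
    unfolding Z2_def by (intro has_symbol_op_mult symbol_N symbol_delta symbol_A symbol_V)
  moreover have "N_symbol ** mat [:1, 0, -1:] ** mat [:1, 0, -1:] ** V_symbol
      = mat ([:1, 0, -1:] * [:1, 0, -1:] * [:1, 0, -1:])"
    by (simp only: matrix_mul_assoc[of N_symbol "mat [:1, 0, -1:]" "mat [:1, 0, -1:]", symmetric]
        mat_mult_mat N_mat_V_symbol)
  moreover have "1 + 2 + 2 + 1 = (6 :: nat)" by simp
  ultimately show "has_symbol 6 (mat ([:1, 0, -1:] * [:1, 0, -1:] * [:1, 0, -1:])) (Z2 \<alpha> \<beta> v)"
    by (simp only:)
qed (intro mat_poly_nonzero, simp)

end

theorem theorem7p5:
  fixes \<alpha> \<beta> v :: real
  assumes "\<bar>\<alpha> - \<beta>\<bar> < \<bar>v\<bar>" and "\<bar>v\<bar> < \<alpha> + \<beta> + 2"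
  shows "op_order (Z1 \<alpha> \<beta> v) = 4 \<and> op_order (Z2 \<alpha> \<beta> v) = 6 \<and>
    weight_center (W \<alpha> \<beta> v) = generated_algebra {op_scalar 1, Z1 \<alpha> \<beta> v, Z2 \<alpha> \<beta> v} \<and>
    is_direct_sum (weight_center (W \<alpha> \<beta> v))
      (range op_scalar)
      {op_N \<alpha> \<beta> v \<odot>\<^sub>o E \<odot>\<^sub>o op_A \<alpha> \<beta> v \<odot>\<^sub>o op_V \<alpha> \<beta> v | E. E \<in> weight_center (W_tilde \<alpha> \<beta>)}"
proof -
  interpret jacobi_parameters \<alpha> \<beta> v
    using assms by unfold_locales
  show ?thesis
    using order_Z1 order_Z2 weight_center_W_generated weight_center_W_eq direct_sum_trivial_intersection
    unfolding is_direct_sum_def by blast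
qed

end
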